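(* Let $\boldsymbol\psi=(N,Q,C_1,C_2,\dots)$ be a nonnegative random vector with $N\in\mathbb N_+\cup\{\infty\}$ and $P(Q>0)>0$, and suppose that for some $\alpha>0$, $E\left[\sum_{i=1}^N C_i^\alpha\right]=1$ and $E\left[\sum_{i=1}^N C_i^\alpha\log C_i\right]\in(0,\infty)$. Let $k\ge0$, let $\boldsymbol i=(i_1,\dots,i_k)\in\mathbb N_+^k$, and let $B\subseteq(\mathbb N_+\cup\{\infty\})\times\mathbb R^\infty$ be measurable. Then $$\widetilde P(\boldsymbol J_k=\boldsymbol i)=\prod_{r=1}^kE\left[C_{i_r}^\alpha1(N\ge i_r)\right],$$ $$\widetilde P(\boldsymbol\psi_{\boldsymbol i}\in B\mid\boldsymbol i\in A_k,\ \boldsymbol i\ne\boldsymbol J_k)=P\left((N,Q,C_1,C_2,\dots)\in B\right),$$ $$\widetilde P(\boldsymbol\psi_{\boldsymbol i}\in B\mid\boldsymbol i=\boldsymbol J_k)=E\left[1\left((N,Q,C_1,C_2,\dots)\in B\right)\sum_{j=1}^NC_j^\alpha\right],$$ the last two identities whenever the conditioning event has positive $\widetilde P$-probability. Moreover, under $\widetilde P$, the vectors $\{\boldsymbol\psi_{\boldsymbol i}:\boldsymbol i\in A_k\}$ are conditionally independent given $\mathcal G_{k-1}$ for any $k\ge1$.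
   Context: Conventions: $0\cdot\log0=0$; empty products equal $1$. Weighted branching tree. Let $U=\bigcup_{k\ge0}\mathbb N_+^k$ be the set of finite sequences of positive integers ($\mathbb N_+^0=\{\emptyset\}$); $(\boldsymbol i,j)$ is concatenation. Let $\boldsymbol\psi_{\boldsymbol i}=(N_{\boldsymbol i},Q_{\boldsymbol i},C_{(\boldsymbol i,1)},C_{(\boldsymbol i,2)},\dots)$, $\boldsymbol i\in U$, be i.i.d. copies of $\boldsymbol\psi=(N,Q,C_1,C_2,\dots)$ (arbitrary dependence within the vector is allowed). Let $A_0=\{\emptyset\}$, $A_n=\{(\boldsymbol i,j):\boldsymbol i\in A_{n-1},\,j\in\mathbb N_+,\,1\le j\le N_{\boldsymbol i}\}$ be the (random) set of individuals in generation $n$. Spine. Let $D_{\boldsymbol i}=\sum_{r=1}^{N_{\boldsymbol i}}C_{(\boldsymbol i,r)}^\alpha$. Set $\boldsymbol J_0=\emptyset$ and, conditionally on all the $\{\boldsymbol\psi_{\boldsymbol i}\}$ and on $\boldsymbol J_0,\dots,\boldsymbol J_{k-1}$, let $\boldsymbol J_k=(\boldsymbol J_{k-1},i)$ with probability $C_{(\boldsymbol J_{k-1},i)}^\alpha/D_{\boldsymbol J_{k-1}}$, $1\le i\le N_{\boldsymbol J_{k-1}}$, $k\ge1$ (on $\{D_{\boldsymbol J_{k-1}}=0\}$, which has $\widetilde P$-probability $0$, set $\boldsymbol J_k=(\boldsymbol J_{k-1},1)$). Change of measure. Let $\mathcal F_k=\sigma(\boldsymbol\psi_{\boldsymbol i}:\boldsymbol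 i\in A_s,\,s<k)$, $\mathcal G_k=\sigma(\mathcal F_k\cup\sigma(\boldsymbol J_s:s\le k))$ for $k\ge1$, $\mathcal F_0=\mathcal G_0$ trivial, and $L_0=1$, $L_k=\prod_{r=0}^{k-1}D_{\boldsymbol J_r}$, a mean-one nonnegative $(\mathcal G_k)$-martingale under $P$. $\widetilde P$ is the probability measure on $\sigma(\bigcup_k\mathcal G_k)$ with $\widetilde P(A)=E[1(A)L_k]$ for $A\in\mathcal G_k$, $k\ge0$.
   Formalization: The conditional independence given G_{k-1} fails as stated (e.g. k=1, N=2, C_1=C_2 in {0,2}, α=1); it is proved instead given G_{k-1} together with A_k and J_k, and also given G_k. *)

theory Defs
  imports "HOL-Probability.Probability" "HOL-Library.Extended_Nat"
begin

text \<open>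
  A value of the vector $(N, Q, C_1, C_2, \ldots)$ is a pair of an extended natural number and a
  point of $\mathbb{R}^\infty$; coordinate 0 of the latter is $Q$ and coordinate $j \ge 1$ is $C_j$.
\<close>

type_synonym mark = "enat \<times> (nat \<Rightarrow> real)"

definition mark_space :: "mark measure" where
  "mark_space = count_space {1..} \<Otimes>\<^sub>M (\<Pi>\<^sub>M j\<in>(UNIV :: nat set). (borel :: real measure))"

definition mark_N :: "mark \<Rightarrow> enat" where
  "mark_N x = fst x"

definition mark_Q :: "mark \<Rightarrow> real" where
  "mark_Q x = snd x 0"

definition mark_C :: "mark \<Rightarrow> nat \<Rightarrow> real" where
  "mark_C x j = snd x j"

text \<open>The possibly infinite sum of $C_r^\alpha$ over $1 \le r \le N$.\<close>

definition weight_sum :: "real \<Rightarrow> mark \<Rightarrow> ennreal" where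
  "weight_sum \<alpha> x =
     (\<Sum>r. if 1 \<le> r \<and> enat r \<le> mark_N x then ennreal (mark_C x r powr \<alpha>) else 0)"

text \<open>
  The term of index \<open>r\<close> in the sum of $C_r^\alpha \log C_r$ over $1 \le r \le N$. If $C_r = 0$ it
  vanishes, since \<open>0 powr \<alpha> = 0\<close>.
\<close>

definition log_weight :: "real \<Rightarrow> mark \<Rightarrow> nat \<Rightarrow> real" where
  "log_weight \<alpha> x r =
     (if 1 \<le> r \<and> enat r \<le> mark_N x then mark_C x r powr \<alpha> * ln (mark_C x r) else 0)"

definition words :: "nat \<Rightarrow> nat list set" where
  "words k = {i \<in> lists {1..}. length i = k}"

text \<open>
  \<open>\<Psi> i \<omega>\<close> is the vector of the individual \<open>i\<close>. The weight $C_{(i,j)}$ of its child \<open>i @ [j]\<close>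
  belongs to the vector of the parent: it is \<open>mark_C (\<Psi> i \<omega>) j\<close>.
\<close>

primrec generation :: "(nat list \<Rightarrow> 'a \<Rightarrow> mark) \<Rightarrow> nat \<Rightarrow> 'a \<Rightarrow> nat list set" where
  "generation \<Psi> 0 \<omega> = {[]}"
| "generation \<Psi> (Suc n) \<omega> =
     {i @ [j] | i j. i \<in> generation \<Psi> n \<omega> \<and> 1 \<le> j \<and> enat j \<le> mark_N (\<Psi> i \<omega>)}"

definition iid_marks ::
  "'a measure \<Rightarrow> ('a \<Rightarrow> mark) \<Rightarrow> (nat list \<Rightarrow> 'a \<Rightarrow> mark) \<Rightarrow> bool" where
  "iid_marks M \<psi> \<Psi> \<longleftrightarrow>
     prob_space.indep_vars M (\<lambda>_. mark_space) \<Psi> (lists {1..}) \<and>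
     (\<forall>i\<in>lists {1..}. distr M mark_space (\<Psi> i) = distr M mark_space \<psi>)"

text \<open>
  $\Psi_i$ counts as observed only where \<open>i\<close> is alive: the sigma-algebra generated by \<open>\<Psi> i\<close>
  restricted to the event that \<open>i\<close> belongs to its generation. The random families
  $\{\Psi_i : i \in A_s\}$ are handled through these sigma-algebras.
\<close>

definition node_algebra :: "'a measure \<Rightarrow> (nat list \<Rightarrow> 'a \<Rightarrow> mark) \<Rightarrow> nat list \<Rightarrow> 'a measure" where
  "node_algebra M \<Psi> i = sigma (space M)
     {{\<omega> \<in> space M. i \<in> generation \<Psi> (length i) \<omega> \<and> \<Psi> i \<omega> \<in> B} | B. B \<in> sets mark_space}"

definition F_alg :: "'a measure \<Rightarrow> (nat list \<Rightarrow> 'a \<Rightarrow> mark) \<Rightarrow> nat \<Rightarrow> 'a measure" where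
  "F_alg M \<Psi> k = sigma (space M) (\<Union>s<k. \<Union>i\<in>words s. sets (node_algebra M \<Psi> i))"

definition J_sets :: "'a measure \<Rightarrow> (nat \<Rightarrow> 'a \<Rightarrow> nat list) \<Rightarrow> nat \<Rightarrow> 'a set set" where
  "J_sets M J s = sets (vimage_algebra (space M) (J s) (count_space UNIV))"

definition G_alg ::
  "'a measure \<Rightarrow> (nat list \<Rightarrow> 'a \<Rightarrow> mark) \<Rightarrow> (nat \<Rightarrow> 'a \<Rightarrow> nat list) \<Rightarrow> nat \<Rightarrow> 'a measure" where
  "G_alg M \<Psi> J k = sigma (space M) (sets (F_alg M \<Psi> k) \<union> (\<Union>s\<le>k. J_sets M J s))"

text \<open>Generated by all the vectors (alive or not) and by $J_0, \ldots, J_k$.\<close>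

definition full_alg ::
  "'a measure \<Rightarrow> (nat list \<Rightarrow> 'a \<Rightarrow> mark) \<Rightarrow> (nat \<Rightarrow> 'a \<Rightarrow> nat list) \<Rightarrow> nat \<Rightarrow> 'a measure" where
  "full_alg M \<Psi> J k = sigma (space M)
     ((\<Union>i\<in>lists {1..}. sets (vimage_algebra (space M) (\<Psi> i) mark_space)) \<union>
      (\<Union>s\<le>k. J_sets M J s))"

definition step_prob :: "real \<Rightarrow> mark \<Rightarrow> nat \<Rightarrow> ennreal" where
  "step_prob \<alpha> x j =
     (if weight_sum \<alpha> x = 0 then (if j = 1 then 1 else 0)
      else if 1 \<le> j \<and> enat j \<le> mark_N x then ennreal (mark_C x j powr \<alpha>) / weight_sum \<alpha> x
      else 0)"

text \<open>
  The next individual of the spine is always a child of the current one, not merely almost surely.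
  Consequently $\{J_k = i\} \subseteq \{i \in A_k\}$, and $\{\Psi_i \in B, J_k = i\}$ is an event of
  $\mathcal{G}_{k+1}$. No completion of the sigma-algebras is involved.
\<close>

definition spine ::
  "'a measure \<Rightarrow> real \<Rightarrow> (nat list \<Rightarrow> 'a \<Rightarrow> mark) \<Rightarrow> (nat \<Rightarrow> 'a \<Rightarrow> nat list) \<Rightarrow> bool" where
  "spine M \<alpha> \<Psi> J \<longleftrightarrow>
     (\<forall>k. J k \<in> measurable M (count_space UNIV)) \<and>
     (\<forall>\<omega>\<in>space M. J 0 \<omega> = []) \<and>
     (\<forall>k. \<forall>\<omega>\<in>space M. \<exists>j\<ge>1. enat j \<le> mark_N (\<Psi> (J k \<omega>) \<omega>) \<and> J (Suc k) \<omega> = J k \<omega> @ [j]) \<and>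
     (\<forall>k. \<forall>j\<ge>1. AE \<omega> in M.
        nn_cond_exp M (full_alg M \<Psi> J k) (indicator {\<omega> \<in> space M. J (Suc k) \<omega> = J k \<omega> @ [j]}) \<omega>
          = step_prob \<alpha> (\<Psi> (J k \<omega>) \<omega>) j)"

definition likelihood ::
  "real \<Rightarrow> (nat list \<Rightarrow> 'a \<Rightarrow> mark) \<Rightarrow> (nat \<Rightarrow> 'a \<Rightarrow> nat list) \<Rightarrow> nat \<Rightarrow> 'a \<Rightarrow> ennreal" where
  "likelihood \<alpha> \<Psi> J k \<omega> = (\<Prod>r<k. weight_sum \<alpha> (\<Psi> (J r \<omega>) \<omega>))"

text \<open>The defining property of $\widetilde{P}$; the case $k = 0$ makes it a probability measure.\<close>

definition tilted_measure ::
  "'a measure \<Rightarrow> real \<Rightarrow> (nat list \<Rightarrow> 'a \<Rightarrow> mark) \<Rightarrow> (nat \<Rightarrow> 'a \<Rightarrow> nat list) \<Rightarrow> 'a measure \<Rightarrow> bool" where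
  "tilted_measure M \<alpha> \<Psi> J Pt \<longleftrightarrow>
     space Pt = space M \<and>
     sets Pt = sigma_sets (space M) (\<Union>k. sets (G_alg M \<Psi> J k)) \<and>
     (\<forall>k. \<forall>A\<in>sets (G_alg M \<Psi> J k).
        emeasure Pt A = (\<integral>\<^sup>+ \<omega>. indicator A \<omega> * likelihood \<alpha> \<Psi> J k \<omega> \<partial>M))"

text \<open>Conditional counterpart of \<^const>\<open>prob_space.indep_sets\<close>.\<close>

definition cond_indep_sets ::
  "'a measure \<Rightarrow> 'a measure \<Rightarrow> ('i \<Rightarrow> 'a set set) \<Rightarrow> 'i set \<Rightarrow> bool" where
  "cond_indep_sets M H E I \<longleftrightarrow>
     subalgebra M H \<and> (\<forall>i\<in>I. E i \<subseteq> sets M) \<and>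
     (\<forall>S\<subseteq>I. S \<noteq> {} \<longrightarrow> finite S \<longrightarrow> (\<forall>A\<in>Pi S E.
        AE \<omega> in M. real_cond_exp M H (indicator (\<Inter>i\<in>S. A i)) \<omega>
          = (\<Prod>i\<in>S. real_cond_exp M H (indicator (A i)) \<omega>)))"

text \<open>
  Conditional independence of $\{\Psi_i : i \in A_k\}$ presupposes that the index set $A_k$ and the
  position $J_k$ of the only vector with a tilted law are known. Neither is determined by
  $\mathcal{G}_{k-1}$, and conditional independence fails without them: for $\alpha = 1$, $N = 2$
  and $C_1 = C_2$ equal to 2 with probability 1/4 and to 0 otherwise, $D_{(1)}$ and $D_{(2)}$ are
  positive with $\widetilde{P}$-probability 5/8 each and jointly with $\widetilde{P}$-probability
  1/4, although $A_1 = \{1, 2\}$ and $\mathcal{G}_0$ is trivial. So $A_k$ and $J_k$ are adjoined to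
  $\mathcal{G}_{k-1}$; the result lies between $\mathcal{G}_{k-1}$ and $\mathcal{G}_k$.
\<close>

definition G_pre_alg ::
  "'a measure \<Rightarrow> (nat list \<Rightarrow> 'a \<Rightarrow> mark) \<Rightarrow> (nat \<Rightarrow> 'a \<Rightarrow> nat list) \<Rightarrow> nat \<Rightarrow> 'a measure" where
  "G_pre_alg M \<Psi> J k = sigma (space M)
     (sets (G_alg M \<Psi> J (k - 1)) \<union>
      {{\<omega> \<in> space M. i \<in> generation \<Psi> k \<omega>} | i. i \<in> words k} \<union> J_sets M J k)"

end

theory Submission
  imports Defs
begin

text \<open>
  Write $D_u$ for the total weight of the marks of the node $u$ and
  $W_i = \prod_{r<k} C_{i|(r+1)}^\alpha 1(i|(r+1) \in A_{r+1})$ for the product of the weights along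
  the path from the root to $i$, a node of length $k$ (\<open>path_weight\<close>). Given all the marks, the
  spine passes through $i$ with probability $W_i / \prod_{r<k} D_{i|r}$ if these $D_{i|r}$ are
  positive, and on that event $L_k = \prod_{r<k} D_{i|r}$. The total weights cancel: for every nonnegative function $H$ of the
  marks alone,
  \[ E[1(J_k = i) L_k H] = E[W_i H] \]
  (\<open>nn_integral_likelihood_on_spine\<close>). The spine has thereby disappeared, and what remains are
  expectations of functions of independent marks. With $H = 1$ the factors of $W_i$ are
  independent, which gives the law of $J_k$ under $\widetilde{P}$.

  The other claims describe generation $n$. On $\{J_n = i\}$ an event of $\mathcal{G}_n$ coincides
  with an event that depends only on the marks of the nodes of length less than $n$
  (\<open>G_alg_trace\<close>), because the earlier positions of the spine are the prefixes of $i$. Passing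
  from $L_n$ to $L_{n+1}$ multiplies by $D_i$. After the cancellation, $W_i$, the event of
  $\mathcal{G}_n$ and the indicators of $\{j \in A_n\}$ involve only marks of nodes of length less
  than $n$, and the marks of generation $n$ are independent of all of these and of each other. So each
  of these marks can be integrated out separately (\<open>nn_integral_resample_generation\<close>): a living
  node $j \neq i$ contributes $P(\psi \in B_j)$, whereas the node $i$, whose mark also carries the
  factor $D_i$, contributes $E[1(\psi \in B_i) \sum_r C_r^\alpha]$. Summed over $i$, this is
  \<open>emeasure_Pt_node_events\<close>: under $\widetilde{P}$ and given $\mathcal{G}_n$, the probability of
  $\bigcap_j \{\Psi_j \in B_j\}$ for living nodes $j$ is the product of these contributions.

  The two conditional distributions are the case of one node and of the events
  $\{i \in A_k, i \neq J_k\}$ and $\{i = J_k\}$. Each contribution depends on $\omega$ only through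
  $J_n$ and $A_n$, so the same product is the conditional probability given any sigma-algebra
  between $\sigma(J_n, A_n)$ and $\mathcal{G}_n$ (\<open>AE_real_cond_exp_node_events\<close>); both conditional
  independence claims follow.
\<close>

section \<open>Weights along a path of the tree\<close>

definition child_weight :: "real \<Rightarrow> mark \<Rightarrow> nat \<Rightarrow> ennreal" where
  "child_weight \<alpha> x j = (if 1 \<le> j \<and> enat j \<le> mark_N x then ennreal (mark_C x j powr \<alpha>) else 0)"

definition path_weight :: "real \<Rightarrow> (nat list \<Rightarrow> 'a \<Rightarrow> mark) \<Rightarrow> nat list \<Rightarrow> 'a \<Rightarrow> ennreal" where
  "path_weight \<alpha> \<Psi> i \<omega> = (\<Prod>r<length i. child_weight \<alpha> (\<Psi> (take r i) \<omega>) (i ! r))"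

lemma weight_sum_eq_suminf_child_weight: "weight_sum \<alpha> x = (\<Sum>j. child_weight \<alpha> x j)"
  by (simp add: weight_sum_def child_weight_def)

lemma child_weight_le_weight_sum: "child_weight \<alpha> x j \<le> weight_sum \<alpha> x"
proof -
  have "(\<Sum>r\<in>{j}. child_weight \<alpha> x r) \<le> (\<Sum>r. child_weight \<alpha> x r)"
    by (rule sum_le_suminf) auto
  then show ?thesis by (simp add: weight_sum_eq_suminf_child_weight)
qed

text \<open>
  The cancellation between the likelihood and the transition probabilities of the spine. It is
  valid also where the total weight vanishes and the spine moves to the first child by convention,
  since then the weight of that child is 0 too. An infinite total weight has to be excluded,
  because there the left-hand side is $\infty \cdot 0 = 0$.
\<close>

lemma weight_sum_mult_step_prob:
  assumes "weight_sum \<alpha> x < \<infinity>"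
  shows "weight_sum \<alpha> x * step_prob \<alpha> x j = child_weight \<alpha> x j"
proof (cases "weight_sum \<alpha> x = 0")
  case True
  then show ?thesis using child_weight_le_weight_sum[of \<alpha> x j] by simp
next
  case False
  then have "weight_sum \<alpha> x * (ennreal c / weight_sum \<alpha> x) = ennreal c" for c
    using assms by (simp add: ennreal_times_divide mult.commute[of "weight_sum \<alpha> x"] ennreal_mult_divide_eq)
  then show ?thesis using False by (simp add: step_prob_def child_weight_def)
qed

lemma mark_N_measurable_pred [measurable]: "Measurable.pred mark_space (\<lambda>x. enat j \<le> mark_N x)"
proof -
  have "fst \<in> measurable mark_space (count_space {1..} :: enat measure)"
    unfolding mark_space_def by measurable
  then have "(\<lambda>x. enat j \<le> fst x) \<in> measurable mark_space (count_space UNIV)"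
    by (rule measurable_compose) simp
  then show ?thesis by (simp add: mark_N_def)
qed

lemma mark_C_measurable [measurable]: "(\<lambda>x. mark_C x j) \<in> borel_measurable mark_space"
  unfolding mark_C_def mark_space_def by measurable

lemma child_weight_measurable [measurable]: "(\<lambda>x. child_weight \<alpha> x j) \<in> borel_measurable mark_space"
  unfolding child_weight_def by measurable

lemma weight_sum_measurable [measurable]: "weight_sum \<alpha> \<in> borel_measurable mark_space"
  unfolding weight_sum_eq_suminf_child_weight[abs_def] by measurable

lemma step_prob_measurable [measurable]: "(\<lambda>x. step_prob \<alpha> x j) \<in> borel_measurable mark_space"
  unfolding step_prob_def by measurable

text \<open>
  Being alive is a condition on the marks of the proper prefixes only. This is why the marks of the
  nodes of length $n$ are independent of $A_n$.
\<close>

lemma generation_iff: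
  "i \<in> generation \<Psi> n \<omega> \<longleftrightarrow>
     length i = n \<and> (\<forall>r<n. 1 \<le> i ! r \<and> enat (i ! r) \<le> mark_N (\<Psi> (take r i) \<omega>))"
proof (induction n arbitrary: i)
  case (Suc n)
  show ?case
  proof (cases i rule: rev_cases)
    case (snoc i' j)
    then have "i \<in> generation \<Psi> (Suc n) \<omega> \<longleftrightarrow> i' \<in> generation \<Psi> n \<omega> \<and> 1 \<le> j \<and> enat j \<le> mark_N (\<Psi> i' \<omega>)"
      by auto
    also have "\<dots> \<longleftrightarrow> length i = Suc n \<and> (\<forall>r<Suc n. 1 \<le> i ! r \<and> enat (i ! r) \<le> mark_N (\<Psi> (take r i) \<omega>))"
      using snoc by (auto simp: Suc.IH nth_append less_Suc_eq)
    finally show ?thesis .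
  qed simp
qed simp

lemma path_weight_snoc:
  "path_weight \<alpha> \<Psi> (i @ [j]) \<omega> = path_weight \<alpha> \<Psi> i \<omega> * child_weight \<alpha> (\<Psi> i \<omega>) j"
  by (simp add: path_weight_def nth_append)

text \<open>
  A path weight includes the indicators that the nodes of the path are alive, so that in its
  presence the node may be assumed to be alive.
\<close>

lemma path_weight_eq_0:
  assumes "i \<notin> generation \<Psi> (length i) \<omega>"
  shows "path_weight \<alpha> \<Psi> i \<omega> = 0"
proof -
  obtain r where "r < length i" "child_weight \<alpha> (\<Psi> (take r i) \<omega>) (i ! r) = 0"
    using assms by (auto simp: generation_iff child_weight_def)
  then show ?thesis by (auto simp: path_weight_def)
qed

lemma words_Suc: "i \<in> words (Suc k) \<longleftrightarrow> (\<exists>i' j. i = i' @ [j] \<and> i' \<in> words k \<and> 1 \<le> j)"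
  by (cases i rule: rev_cases) (auto simp: words_def)

lemma generation_subset_words: "generation \<Psi> n \<omega> \<subseteq> words n"
  by (force simp: generation_iff words_def in_set_conv_nth)

lemma sets_vimage_algebra_Pow: "sets (vimage_algebra X f N) \<subseteq> Pow X"
  using sets.space_closed[of "vimage_algebra X f N"] by simp

section \<open>Resampling independent marks\<close>

locale branching_marks = prob_space M for M :: "'a measure" +
  fixes \<psi> :: "'a \<Rightarrow> mark" and \<Psi> :: "nat list \<Rightarrow> 'a \<Rightarrow> mark"
  assumes mark_rv [measurable]: "\<psi> \<in> measurable M mark_space"
    and iid: "iid_marks M \<psi> \<Psi>"
begin

abbreviation nodes_below :: "nat \<Rightarrow> nat list set" where
  "nodes_below n \<equiv> {u \<in> lists {1..}. length u < n}"

lemma take_nodes_below: "i \<in> words n \<Longrightarrow> r < n \<Longrightarrow> take r i \<in> nodes_below n"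
  by (auto simp: words_def dest: in_set_takeD)

text \<open>
  In contrast to \<^const>\<open>node_algebra\<close>, the mark of a node of \<open>I\<close> is recorded here whether or
  not the node is alive. These sigma-algebras are independent for disjoint index sets.
\<close>

definition mark_algebra :: "nat list set \<Rightarrow> 'a measure" where
  "mark_algebra I = sigma (space M) (\<Union>u\<in>I. {\<Psi> u -` B \<inter> space M | B. B \<in> sets mark_space})"

lemma space_mark_algebra [simp]: "space (mark_algebra I) = space M"
  by (simp add: mark_algebra_def space_measure_of_conv)

lemma sets_mark_algebra:
  "sets (mark_algebra I) =
     sigma_sets (space M) (\<Union>u\<in>I. {\<Psi> u -` B \<inter> space M | B. B \<in> sets mark_space})"
  unfolding mark_algebra_def by (rule sets_measure_of) auto

lemma node_rv: "u \<in> lists {1..} \<Longrightarrow> \<Psi> u \<in> measurable M mark_space"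
  using iid by (auto simp: iid_marks_def indep_vars_def)

lemma node_measurable:
  assumes "u \<in> I" "u \<in> lists {1..}"
  shows "\<Psi> u \<in> measurable (mark_algebra I) mark_space"
proof (rule measurableI)
  show "\<Psi> u \<omega> \<in> space mark_space" if "\<omega> \<in> space (mark_algebra I)" for \<omega>
    using that measurable_space[OF node_rv[OF assms(2)]] by simp
  show "\<Psi> u -` B \<inter> space (mark_algebra I) \<in> sets (mark_algebra I)" if "B \<in> sets mark_space" for B
    using that assms(1) by (auto simp: sets_mark_algebra)
qed

lemma sets_mark_algebra_mono: "I \<subseteq> I' \<Longrightarrow> sets (mark_algebra I) \<subseteq> sets (mark_algebra I')"
  unfolding sets_mark_algebra by (rule sigma_sets_mono') auto

lemma measurable_mark_algebra_mono:
  assumes "f \<in> measurable (mark_algebra I) N" "I \<subseteq> I'"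
  shows "f \<in> measurable (mark_algebra I') N"
  using assms sets_mark_algebra_mono[OF assms(2)] by (auto simp: measurable_def)

lemma sets_mark_algebra_events:
  assumes "I \<subseteq> lists {1..}"
  shows "sets (mark_algebra I) \<subseteq> events"
  unfolding sets_mark_algebra
  using assms by (intro sets.sigma_sets_subset) (auto intro!: measurable_sets[OF node_rv])

lemma measurable_mark_algebra_rv:
  assumes "f \<in> measurable (mark_algebra I) N" "I \<subseteq> lists {1..}"
  shows "f \<in> measurable M N"
  using assms sets_mark_algebra_events[OF assms(2)] by (auto simp: measurable_def)

lemma pred_generation_mark_algebra:
  assumes "\<And>r. r < n \<Longrightarrow> take r i \<in> I" "I \<subseteq> lists {1..}"
  shows "Measurable.pred (mark_algebra I) (\<lambda>\<omega>. i \<in> generation \<Psi> n \<omega>)"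
proof -
  have [measurable]: "\<Psi> (take r i) \<in> measurable (mark_algebra I) mark_space" if "r \<in> {..<n}" for r
    using that assms by (intro node_measurable) auto
  have "(\<lambda>\<omega>. i \<in> generation \<Psi> n \<omega>) =
     (\<lambda>\<omega>. length i = n \<and> (\<forall>r\<in>{..<n}. 1 \<le> i ! r \<and> enat (i ! r) \<le> mark_N (\<Psi> (take r i) \<omega>)))"
    by (auto simp: generation_iff fun_eq_iff)
  also have "Measurable.pred (mark_algebra I) \<dots>"
    by measurable
  finally show ?thesis .
qed

lemma path_weight_measurable:
  assumes "\<And>r. r < length i \<Longrightarrow> take r i \<in> I" "I \<subseteq> lists {1..}"
  shows "path_weight \<alpha> \<Psi> i \<in> borel_measurable (mark_algebra I)"
proof -
  have [measurable]: "\<Psi> (take r i) \<in> measurable (mark_algebra I) mark_space" if "r \<in> {..<length i}" for r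
    using that assms by (intro node_measurable) auto
  show ?thesis unfolding path_weight_def[abs_def] by measurable
qed

lemma nn_integral_node:
  assumes "v \<in> lists {1..}" "g \<in> borel_measurable mark_space"
  shows "(\<integral>\<^sup>+ \<omega>. g (\<Psi> v \<omega>) \<partial>M) = (\<integral>\<^sup>+ \<omega>. g (\<psi> \<omega>) \<partial>M)"
proof -
  have "(\<integral>\<^sup>+ \<omega>. g (\<Psi> v \<omega>) \<partial>M) = (\<integral>\<^sup>+ x. g x \<partial>distr M mark_space (\<Psi> v))"
    using assms node_rv by (simp add: nn_integral_distr)
  also have "distr M mark_space (\<Psi> v) = distr M mark_space \<psi>"
    using iid assms(1) by (auto simp: iid_marks_def)
  finally show ?thesis using assms mark_rv by (simp add: nn_integral_distr)
qed

lemma indep_sets_mark_algebra: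
  assumes "v \<in> lists {1..}" "I \<subseteq> lists {1..}" "v \<notin> I"
  shows "indep_sets (\<lambda>b. sets (mark_algebra (if b then I else {v}))) UNIV"
  unfolding sets_mark_algebra
proof (rule indep_sets_collect_sigma)
  have "indep_sets (\<lambda>u. {\<Psi> u -` B \<inter> space M | B. B \<in> sets mark_space}) (lists {1..})"
    using iid by (auto simp: iid_marks_def indep_vars_def2)
  then show "indep_sets (\<lambda>u. {\<Psi> u -` B \<inter> space M | B. B \<in> sets mark_space})
      (\<Union>b\<in>UNIV. if b then I else {v})"
    by (rule indep_sets_mono_index[rotated]) (use assms in \<open>auto split: if_splits\<close>)
  show "Int_stable {\<Psi> u -` B \<inter> space M | B. B \<in> sets mark_space}" for u
  proof (rule Int_stableI, clarsimp)
    fix B B' assume "B \<in> sets mark_space" "B' \<in> sets mark_space"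
    then show "\<exists>B''. \<Psi> u -` B \<inter> space M \<inter> (\<Psi> u -` B' \<inter> space M) = \<Psi> u -` B'' \<inter> space M \<and> B'' \<in> sets mark_space"
      by (intro exI[of _ "B \<inter> B'"]) auto
  qed
  show "disjoint_family_on (\<lambda>b. if b then I else {v}) UNIV"
    using assms by (auto simp: disjoint_family_on_def)
qed

text \<open>
  The only form in which independence is used: one mark is integrated out against a function
  of other marks.
\<close>

lemma nn_integral_mult_node:
  assumes v: "v \<in> lists {1..}" "v \<notin> I" and I: "I \<subseteq> lists {1..}"
    and Z: "Z \<in> borel_measurable (mark_algebra I)" and g: "g \<in> borel_measurable mark_space"
  shows "(\<integral>\<^sup>+ \<omega>. Z \<omega> * g (\<Psi> v \<omega>) \<partial>M) = (\<integral>\<^sup>+ \<omega>. Z \<omega> \<partial>M) * (\<integral>\<^sup>+ \<omega>. g (\<psi> \<omega>) \<partial>M)"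
proof -
  define X where "X b = (if b then Z else (\<lambda>\<omega>. g (\<Psi> v \<omega>)))" for b
  have X: "X b \<in> borel_measurable (mark_algebra (if b then I else {v}))" for b
    using Z g node_measurable[of v "{v}"] v by (auto simp: X_def intro: measurable_compose)
  have "indep_vars (\<lambda>_. borel) X UNIV"
    unfolding indep_vars_def2
  proof (intro conjI ballI)
    show "X b \<in> borel_measurable M" for b
      using v I by (intro measurable_mark_algebra_rv[OF X]) auto
    show "indep_sets (\<lambda>b. {X b -` A \<inter> space M |A. A \<in> sets borel}) UNIV"
    proof (rule indep_sets_mono_sets[OF indep_sets_mark_algebra[OF v(1) I v(2)]])
      show "{X b -` A \<inter> space M |A. A \<in> sets borel} \<subseteq> sets (mark_algebra (if b then I else {v}))" for b
        using measurable_sets[OF X[of b]] by auto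
    qed
  qed
  from indep_vars_nn_integral[OF _ this]
  have "(\<integral>\<^sup>+ \<omega>. Z \<omega> * g (\<Psi> v \<omega>) \<partial>M) = (\<integral>\<^sup>+ \<omega>. Z \<omega> \<partial>M) * (\<integral>\<^sup>+ \<omega>. g (\<Psi> v \<omega>) \<partial>M)"
    by (simp add: UNIV_bool X_def mult.commute)
  then show ?thesis using nn_integral_node[OF v(1) g] by simp
qed

text \<open>
  Integrates out the marks of finitely many nodes of generation \<open>n\<close>, one after the other. The
  set \<open>I\<close> of marks on which \<open>Z\<close> may depend is arbitrary apart from containing the earlier
  generations and avoiding \<open>T\<close>, because in the induction the factor of the node \<open>v\<close> that is
  not yet treated is absorbed into \<open>Z\<close>.
\<close>

lemma nn_integral_resample_generation:
  assumes "finite T" "T \<subseteq> words n" "I \<subseteq> lists {1..}" "I \<inter> T = {}" "nodes_below n \<subseteq> I"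
    and "Z \<in> borel_measurable (mark_algebra I)"
    and g: "\<And>j. g j \<in> borel_measurable mark_space"
  shows "(\<integral>\<^sup>+ \<omega>. Z \<omega> * (\<Prod>j\<in>T. if j \<in> generation \<Psi> n \<omega> then g j (\<Psi> j \<omega>) else c j) \<partial>M) =
    (\<integral>\<^sup>+ \<omega>. Z \<omega> * (\<Prod>j\<in>T. if j \<in> generation \<Psi> n \<omega> then \<integral>\<^sup>+ \<omega>. g j (\<psi> \<omega>) \<partial>M else c j) \<partial>M)"
  using assms(1-6)
proof (induction T arbitrary: I Z rule: finite_induct)
  case (insert v T)
  define f where "f j \<omega> = (if j \<in> generation \<Psi> n \<omega> then g j (\<Psi> j \<omega>) else c j)" for j \<omega>
  define m where "m j \<omega> = (if j \<in> generation \<Psi> n \<omega> then \<integral>\<^sup>+ \<omega>. g j (\<psi> \<omega>) \<partial>M else c j)" for j \<omega>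
  have v: "v \<in> words n" "v \<in> lists {1..}" "v \<notin> I"
    using insert.prems by (auto simp: words_def)
  have gen: "Measurable.pred (mark_algebra I') (\<lambda>\<omega>. j \<in> generation \<Psi> n \<omega>)"
    if "j \<in> words n" "I \<subseteq> I'" "I' \<subseteq> lists {1..}" for j I'
  proof (rule pred_generation_mark_algebra)
    show "take r j \<in> I'" if "r < n" for r
    proof -
      have "take r j \<in> nodes_below n"
        using \<open>j \<in> words n\<close> \<open>r < n\<close> by (rule take_nodes_below)
      then show ?thesis using insert.prems(4) \<open>I \<subseteq> I'\<close> by blast
    qed
  qed fact
  have m: "m j \<in> borel_measurable (mark_algebra I)" if "j \<in> insert v T" for j
  proof -
    have [measurable]: "Measurable.pred (mark_algebra I) (\<lambda>\<omega>. j \<in> generation \<Psi> n \<omega>)"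
      using that insert.prems(1,2) by (intro gen) auto
    show ?thesis unfolding m_def[abs_def] by measurable
  qed
  have gv [measurable]: "Measurable.pred (mark_algebra I) (\<lambda>\<omega>. v \<in> generation \<Psi> n \<omega>)"
    by (rule gen) (use v insert.prems in auto)
  have f: "f v \<in> borel_measurable (mark_algebra (insert v I))"
  proof -
    have [measurable]: "\<Psi> v \<in> measurable (mark_algebra (insert v I)) mark_space"
      by (rule node_measurable) (use v in auto)
    have [measurable]: "Measurable.pred (mark_algebra (insert v I)) (\<lambda>\<omega>. v \<in> generation \<Psi> n \<omega>)"
      by (rule gen) (use v insert.prems in auto)
    note g[measurable]
    show ?thesis unfolding f_def[abs_def] by measurable
  qed
  have Zv: "Z \<in> borel_measurable (mark_algebra (insert v I))"
    by (rule measurable_mark_algebra_mono[OF insert.prems(5)]) auto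
  \<comment> \<open>With the nodes of \<open>T\<close> integrated out, everything but the factor of \<open>v\<close> is a function of
    the marks in \<open>I\<close>, which does not contain \<open>v\<close>.\<close>
  define Y where "Y \<omega> = Z \<omega> * (\<Prod>j\<in>T. m j \<omega>)" for \<omega>
  have Y [measurable]: "Y \<in> borel_measurable (mark_algebra I)"
    unfolding Y_def[abs_def] using insert.prems(5) m by (intro borel_measurable_times_ennreal borel_measurable_prod_ennreal) auto
  have YM: "f' \<in> borel_measurable M" if "f' \<in> borel_measurable (mark_algebra I)" for f' :: "'a \<Rightarrow> ennreal"
    using that insert.prems(2) by (rule measurable_mark_algebra_rv)
  have gM [measurable]: "(\<lambda>\<omega>. g v (\<Psi> v \<omega>)) \<in> borel_measurable M"
    using node_rv[OF v(2)] g by (rule measurable_compose)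
  have "(\<integral>\<^sup>+ \<omega>. Z \<omega> * (\<Prod>j\<in>insert v T. f j \<omega>) \<partial>M) = (\<integral>\<^sup>+ \<omega>. (Z \<omega> * f v \<omega>) * (\<Prod>j\<in>T. f j \<omega>) \<partial>M)"
    using insert.hyps by (simp add: mult.assoc)
  also have "\<dots> = (\<integral>\<^sup>+ \<omega>. (Z \<omega> * f v \<omega>) * (\<Prod>j\<in>T. m j \<omega>) \<partial>M)"
    unfolding f_def m_def
    by (rule insert.IH[of "insert v I"])
       (use insert.prems insert.hyps v Zv f[unfolded f_def[abs_def]] in \<open>auto simp: f_def[abs_def] intro!: borel_measurable_times_ennreal\<close>)
  also have "\<dots> = (\<integral>\<^sup>+ \<omega>. (Y \<omega> * indicator {\<omega>. v \<in> generation \<Psi> n \<omega>} \<omega>) * g v (\<Psi> v \<omega>)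
      + Y \<omega> * (if v \<in> generation \<Psi> n \<omega> then 0 else c v) \<partial>M)"
    by (intro nn_integral_cong) (auto simp: Y_def f_def mult_ac)
  also have "\<dots> = (\<integral>\<^sup>+ \<omega>. (Y \<omega> * indicator {\<omega>. v \<in> generation \<Psi> n \<omega>} \<omega>) * g v (\<Psi> v \<omega>) \<partial>M)
      + (\<integral>\<^sup>+ \<omega>. Y \<omega> * (if v \<in> generation \<Psi> n \<omega> then 0 else c v) \<partial>M)"
    by (rule nn_integral_add) (intro borel_measurable_times_ennreal gM YM; measurable)+
  also have "(\<integral>\<^sup>+ \<omega>. (Y \<omega> * indicator {\<omega>. v \<in> generation \<Psi> n \<omega>} \<omega>) * g v (\<Psi> v \<omega>) \<partial>M)
     = (\<integral>\<^sup>+ \<omega>. Y \<omega> * indicator {\<omega>. v \<in> generation \<Psi> n \<omega>} \<omega> \<partial>M) * (\<integral>\<^sup>+ \<omega>. g v (\<psi> \<omega>) \<partial>M)"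
    by (rule nn_integral_mult_node[OF v(2,3) insert.prems(2) _ g]) measurable
  also have "\<dots> = (\<integral>\<^sup>+ \<omega>. (Y \<omega> * indicator {\<omega>. v \<in> generation \<Psi> n \<omega>} \<omega>) * (\<integral>\<^sup>+ \<omega>. g v (\<psi> \<omega>) \<partial>M) \<partial>M)"
    by (rule nn_integral_multc[symmetric], rule YM) measurable
  also have "\<dots> + (\<integral>\<^sup>+ \<omega>. Y \<omega> * (if v \<in> generation \<Psi> n \<omega> then 0 else c v) \<partial>M) =
     (\<integral>\<^sup>+ \<omega>. (Y \<omega> * indicator {\<omega>. v \<in> generation \<Psi> n \<omega>} \<omega>) * (\<integral>\<^sup>+ \<omega>. g v (\<psi> \<omega>) \<partial>M)
      + Y \<omega> * (if v \<in> generation \<Psi> n \<omega> then 0 else c v) \<partial>M)"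
    by (rule nn_integral_add[symmetric]; rule YM; measurable)
  also have "\<dots> = (\<integral>\<^sup>+ \<omega>. Z \<omega> * (\<Prod>j\<in>insert v T. m j \<omega>) \<partial>M)"
    using insert.hyps by (intro nn_integral_cong) (auto simp: Y_def m_def mult_ac)
  finally show ?case unfolding f_def m_def .
qed simp

end

section \<open>The law of the spine under the original measure\<close>

locale branching_spine = branching_marks M \<psi> \<Psi> for M :: "'a measure" and \<psi> \<Psi> +
  fixes \<alpha> :: real and J :: "nat \<Rightarrow> 'a \<Rightarrow> nat list"
  assumes mean_weight_sum: "(\<integral>\<^sup>+ \<omega>. weight_sum \<alpha> (\<psi> \<omega>) \<partial>M) = 1"
    and spine: "spine M \<alpha> \<Psi> J"
begin

lemma J_rv [measurable]: "J k \<in> measurable M (count_space UNIV)"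
  using spine by (auto simp: spine_def)

lemma J_0: "\<omega> \<in> space M \<Longrightarrow> J 0 \<omega> = []"
  using spine by (auto simp: spine_def)

lemma J_Suc:
  assumes "\<omega> \<in> space M"
  obtains j where "1 \<le> j" "enat j \<le> mark_N (\<Psi> (J k \<omega>) \<omega>)" "J (Suc k) \<omega> = J k \<omega> @ [j]"
  using spine assms unfolding spine_def by blast

lemma J_in_generation: "\<omega> \<in> space M \<Longrightarrow> J k \<omega> \<in> generation \<Psi> k \<omega>"
proof (induction k)
  case (Suc k)
  obtain j where "1 \<le> j" "enat j \<le> mark_N (\<Psi> (J k \<omega>) \<omega>)" "J (Suc k) \<omega> = J k \<omega> @ [j]"
    using J_Suc[OF Suc.prems] .
  with Suc show ?case by auto
qed (simp add: J_0)

lemma J_in_words: "\<omega> \<in> space M \<Longrightarrow> J k \<omega> \<in> words k"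
  by (rule subsetD[OF generation_subset_words J_in_generation])

lemma J_prefix: "\<omega> \<in> space M \<Longrightarrow> s \<le> k \<Longrightarrow> J s \<omega> = take s (J k \<omega>)"
proof (induction k)
  case (Suc k)
  have "length (J k \<omega>) = k" "length (J (Suc k) \<omega>) = Suc k"
    using J_in_words[OF Suc.prems(1)] by (auto simp: words_def)
  moreover obtain j where "J (Suc k) \<omega> = J k \<omega> @ [j]"
    using J_Suc[OF Suc.prems(1)] by metis
  ultimately show ?case
    using Suc by (cases "s = Suc k") (simp_all add: le_Suc_eq)
qed (simp add: J_0)

lemma likelihood_on_spine:
  assumes "\<omega> \<in> space M" "J k \<omega> = i"
  shows "likelihood \<alpha> \<Psi> J k \<omega> = (\<Prod>r<k. weight_sum \<alpha> (\<Psi> (take r i) \<omega>))"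
  unfolding likelihood_def using J_prefix[OF assms(1), of _ k] assms(2) by (intro prod.cong) auto

lemma likelihood_rv [measurable]: "likelihood \<alpha> \<Psi> J k \<in> borel_measurable M"
proof -
  have "(\<lambda>\<omega>. \<Prod>r<k. weight_sum \<alpha> (\<Psi> (take r (J k \<omega>)) \<omega>)) \<in> borel_measurable M"
  proof (rule measurable_compose_countable'[where I = "words k" and g = "J k"])
    show "(\<lambda>\<omega>. \<Prod>r<k. weight_sum \<alpha> (\<Psi> (take r i) \<omega>)) \<in> borel_measurable M" if "i \<in> words k" for i
    proof -
      have [measurable]: "\<Psi> (take r i) \<in> measurable M mark_space" if "r \<in> {..<k}" for r
        using take_nodes_below[OF \<open>i \<in> words k\<close>] that by (intro node_rv) auto
      show ?thesis by measurable
    qed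
    show "J k \<in> measurable M (count_space (words k))"
      by (rule measurable_count_space_extend[of _ UNIV]) (use J_in_words in auto)
  qed simp
  then show ?thesis
    by (rule measurable_cong[THEN iffD1, rotated]) (simp add: likelihood_on_spine)
qed

text \<open>
  There are only countably many possible positions of the spine, so it suffices to compare
  integrals on the event that the position is a given node.
\<close>

lemma nn_integral_cong_on_spine:
  assumes f: "f \<in> borel_measurable M" and g: "g \<in> borel_measurable M"
    and eq: "\<And>i. i \<in> words k \<Longrightarrow>
      (\<integral>\<^sup>+ \<omega>. indicator {\<omega>. J k \<omega> = i} \<omega> * f \<omega> \<partial>M) = (\<integral>\<^sup>+ \<omega>. indicator {\<omega>. J k \<omega> = i} \<omega> * g \<omega> \<partial>M)"
  shows "(\<integral>\<^sup>+ \<omega>. f \<omega> \<partial>M) = (\<integral>\<^sup>+ \<omega>. g \<omega> \<partial>M)"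
proof -
  have split: "(\<integral>\<^sup>+ \<omega>. h \<omega> \<partial>M) =
      (\<integral>\<^sup>+ i. (\<integral>\<^sup>+ \<omega>. indicator {\<omega>. J k \<omega> = i} \<omega> * h \<omega> \<partial>M) \<partial>count_space (words k))"
    if [measurable]: "h \<in> borel_measurable M" for h :: "'a \<Rightarrow> ennreal"
  proof -
    have "(\<integral>\<^sup>+ i. indicator {\<omega>. J k \<omega> = i} \<omega> * h \<omega> \<partial>count_space (words k)) = h \<omega>"
      if "\<omega> \<in> space M" for \<omega>
    proof -
      have "(\<integral>\<^sup>+ i. indicator {\<omega>. J k \<omega> = i} \<omega> * h \<omega> \<partial>count_space (words k)) =
        (\<integral>\<^sup>+ i. h \<omega> * indicator {J k \<omega>} i \<partial>count_space (words k))"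
        by (intro nn_integral_cong) (auto split: split_indicator)
      then show ?thesis using J_in_words[OF that] by simp
    qed
    then have "(\<integral>\<^sup>+ \<omega>. h \<omega> \<partial>M) =
        (\<integral>\<^sup>+ \<omega>. (\<integral>\<^sup>+ i. indicator {\<omega>. J k \<omega> = i} \<omega> * h \<omega> \<partial>count_space (words k)) \<partial>M)"
      by (intro nn_integral_cong) simp
    also have "\<dots> = (\<integral>\<^sup>+ i. (\<integral>\<^sup>+ \<omega>. indicator {\<omega>. J k \<omega> = i} \<omega> * h \<omega> \<partial>M) \<partial>count_space (words k))"
      by (rule nn_integral_count_space_nn_integral) auto
    finally show ?thesis .
  qed
  show ?thesis unfolding split[OF f] split[OF g] by (intro nn_integral_cong eq) simp
qed

lemma AE_weight_sum_finite:
  assumes "u \<in> lists {1..}"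
  shows "AE \<omega> in M. weight_sum \<alpha> (\<Psi> u \<omega>) < \<infinity>"
proof -
  have "(\<integral>\<^sup>+ \<omega>. weight_sum \<alpha> (\<Psi> u \<omega>) \<partial>M) = 1"
    using nn_integral_node[OF assms, of "weight_sum \<alpha>"] mean_weight_sum by simp
  then have "AE \<omega> in M. weight_sum \<alpha> (\<Psi> u \<omega>) \<noteq> \<infinity>"
    using node_rv[OF assms] by (intro nn_integral_PInf_AE) auto
  then show ?thesis by (simp add: less_top)
qed

lemma space_full_alg [simp]: "space (full_alg M \<Psi> J k) = space M"
  by (simp add: full_alg_def space_measure_of_conv)

lemma sets_full_alg: "sets (full_alg M \<Psi> J k) = sigma_sets (space M)
     ((\<Union>i\<in>lists {1..}. sets (vimage_algebra (space M) (\<Psi> i) mark_space)) \<union> (\<Union>s\<le>k. J_sets M J s))"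
  unfolding full_alg_def J_sets_def
  by (intro sets_measure_of Un_least UN_least sets_vimage_algebra_Pow)

lemma J_sets_iff: "A \<in> J_sets M J s \<longleftrightarrow> (\<exists>X. A = J s -` X \<inter> space M)"
  by (simp add: J_sets_def sets_vimage_algebra2)

lemma subalgebra_full_alg: "subalgebra M (full_alg M \<Psi> J k)"
  unfolding subalgebra_def sets_full_alg
proof (intro conjI sets.sigma_sets_subset Un_least UN_least)
  show "sets (vimage_algebra (space M) (\<Psi> i) mark_space) \<subseteq> events" if "i \<in> lists {1..}" for i
    by (rule sets_image_in_sets[OF refl node_rv[OF that]])
  show "J_sets M J s \<subseteq> events" for s
    by (auto simp: J_sets_iff)
qed simp

lemma J_measurable_full_alg: "J k \<in> measurable (full_alg M \<Psi> J k) (count_space UNIV)"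
proof (rule measurableI)
  fix X :: "nat list set"
  have "J k -` X \<inter> space M \<in> J_sets M J k" by (auto simp: J_sets_iff)
  then show "J k -` X \<inter> space (full_alg M \<Psi> J k) \<in> sets (full_alg M \<Psi> J k)"
    by (simp only: space_full_alg sets_full_alg) (blast intro: sigma_sets.Basic)
qed simp

lemma sets_mark_algebra_full_alg:
  assumes "I \<subseteq> lists {1..}"
  shows "sets (mark_algebra I) \<subseteq> sets (full_alg M \<Psi> J k)"
  unfolding sets_mark_algebra sets_full_alg
  by (rule sigma_sets_mono') (use assms in \<open>auto intro!: in_vimage_algebra\<close>)

text \<open>
  By induction on the length of the path. In the step, everything except the last choice of the
  spine is measurable with respect to the marks and the earlier positions, so that the indicator of
  this choice can be replaced by its conditional expectation, the transition probability. The new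
  factor of the likelihood turns the latter into the weight of the child.
\<close>

lemma nn_integral_likelihood_on_spine:
  assumes "i \<in> words k" "H \<in> borel_measurable (mark_algebra (lists {1..}))"
  shows "(\<integral>\<^sup>+ \<omega>. indicator {\<omega>. J k \<omega> = i} \<omega> * (likelihood \<alpha> \<Psi> J k \<omega> * H \<omega>) \<partial>M) =
    (\<integral>\<^sup>+ \<omega>. path_weight \<alpha> \<Psi> i \<omega> * H \<omega> \<partial>M)"
  using assms
proof (induction k arbitrary: i H)
  case 0
  then show ?case
    by (intro nn_integral_cong) (auto simp: words_def J_0 likelihood_def path_weight_def)
next
  case (Suc k)
  let ?U = "lists {1..} :: nat list set"
  obtain i' j where i: "i = i' @ [j]" "i' \<in> words k" "1 \<le> j"
    using Suc.prems(1) by (auto simp: words_Suc)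
  have i'U: "i' \<in> ?U" using i(2) by (auto simp: words_def)
  note H[measurable] = Suc.prems(2)
  have [measurable]: "\<Psi> i' \<in> measurable (mark_algebra ?U) mark_space"
    by (rule node_measurable[OF i'U i'U])
  have pre [measurable]: "\<Psi> (take r i') \<in> measurable (mark_algebra ?U) mark_space" if "r \<in> {..<k}" for r
    using take_nodes_below[OF i(2)] that by (intro node_measurable) auto
  \<comment> \<open>On \<open>J k \<omega> = i'\<close> this is the new likelihood times \<open>H\<close>, written as a function of the marks
    alone so that it is measurable for the conditioning sigma-algebra.\<close>
  define K where "K \<omega> = (\<Prod>r<k. weight_sum \<alpha> (\<Psi> (take r i') \<omega>)) * (weight_sum \<alpha> (\<Psi> i' \<omega>) * H \<omega>)" for \<omega>
  have "K \<in> borel_measurable (mark_algebra ?U)"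
    unfolding K_def by measurable
  then have K [measurable]: "K \<in> borel_measurable (full_alg M \<Psi> J k)"
    using sets_mark_algebra_full_alg[of ?U k] by (auto simp: measurable_def)
  note J_measurable_full_alg[of k, measurable]
  define F where "F \<omega> = indicator {\<omega>. J k \<omega> = i'} \<omega> * K \<omega>" for \<omega>
  have F: "F \<in> borel_measurable (full_alg M \<Psi> J k)"
    unfolding F_def by measurable
  interpret cond: finite_measure_subalgebra M "full_alg M \<Psi> J k"
    by unfold_locales (rule subalgebra_full_alg)
  let ?step = "{\<omega> \<in> space M. J (Suc k) \<omega> = J k \<omega> @ [j]}"
  have "(\<integral>\<^sup>+ \<omega>. indicator {\<omega>. J (Suc k) \<omega> = i} \<omega> * (likelihood \<alpha> \<Psi> J (Suc k) \<omega> * H \<omega>) \<partial>M) =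
      (\<integral>\<^sup>+ \<omega>. F \<omega> * indicator ?step \<omega> \<partial>M)"
  proof (intro nn_integral_cong)
    fix \<omega> assume \<omega>: "\<omega> \<in> space M"
    have iff: "J (Suc k) \<omega> = i \<longleftrightarrow> J k \<omega> = i' \<and> J (Suc k) \<omega> = J k \<omega> @ [j]"
    proof -
      obtain j' where "J (Suc k) \<omega> = J k \<omega> @ [j']"
        using J_Suc[OF \<omega>] by metis
      then show ?thesis using i(1) by auto
    qed
    show "indicator {\<omega>. J (Suc k) \<omega> = i} \<omega> * (likelihood \<alpha> \<Psi> J (Suc k) \<omega> * H \<omega>) = F \<omega> * indicator ?step \<omega>"
    proof (cases "J (Suc k) \<omega> = i")
      case True
      then have *: "J k \<omega> = i'" "J (Suc k) \<omega> = J k \<omega> @ [j]" using iff by auto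
      have "likelihood \<alpha> \<Psi> J (Suc k) \<omega> = likelihood \<alpha> \<Psi> J k \<omega> * weight_sum \<alpha> (\<Psi> i' \<omega>)"
        by (simp add: likelihood_def *(1))
      then show ?thesis using True * \<omega> likelihood_on_spine[OF \<omega> *(1)]
        by (simp add: F_def K_def mult.assoc)
    next
      case False
      then show ?thesis using iff by (auto simp: F_def split: split_indicator)
    qed
  qed
  also have "\<dots> = (\<integral>\<^sup>+ \<omega>. F \<omega> * nn_cond_exp M (full_alg M \<Psi> J k) (indicator ?step) \<omega> \<partial>M)"
    by (rule cond.nn_cond_exp_intg[symmetric, OF F]) measurable
  also have "\<dots> = (\<integral>\<^sup>+ \<omega>. F \<omega> * step_prob \<alpha> (\<Psi> (J k \<omega>) \<omega>) j \<partial>M)"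
  proof (rule nn_integral_cong_AE)
    have "AE \<omega> in M. nn_cond_exp M (full_alg M \<Psi> J k) (indicator ?step) \<omega> = step_prob \<alpha> (\<Psi> (J k \<omega>) \<omega>) j"
      using spine i(3) by (auto simp: spine_def)
    then show "AE \<omega> in M. F \<omega> * nn_cond_exp M (full_alg M \<Psi> J k) (indicator ?step) \<omega> =
        F \<omega> * step_prob \<alpha> (\<Psi> (J k \<omega>) \<omega>) j"
      by eventually_elim simp
  qed
  also have "\<dots> = (\<integral>\<^sup>+ \<omega>. indicator {\<omega>. J k \<omega> = i'} \<omega> * (likelihood \<alpha> \<Psi> J k \<omega> *
      (weight_sum \<alpha> (\<Psi> i' \<omega>) * step_prob \<alpha> (\<Psi> i' \<omega>) j * H \<omega>)) \<partial>M)"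
    by (intro nn_integral_cong)
       (auto simp: F_def K_def likelihood_on_spine mult_ac split: split_indicator)
  also have "\<dots> = (\<integral>\<^sup>+ \<omega>. path_weight \<alpha> \<Psi> i' \<omega> *
      (weight_sum \<alpha> (\<Psi> i' \<omega>) * step_prob \<alpha> (\<Psi> i' \<omega>) j * H \<omega>) \<partial>M)"
    by (rule Suc.IH[OF i(2)]) measurable
  also have "\<dots> = (\<integral>\<^sup>+ \<omega>. path_weight \<alpha> \<Psi> i \<omega> * H \<omega> \<partial>M)"
  proof (rule nn_integral_cong_AE)
    from AE_weight_sum_finite[OF i'U]
    show "AE \<omega> in M. path_weight \<alpha> \<Psi> i' \<omega> * (weight_sum \<alpha> (\<Psi> i' \<omega>) * step_prob \<alpha> (\<Psi> i' \<omega>) j * H \<omega>) =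
        path_weight \<alpha> \<Psi> i \<omega> * H \<omega>"
      by eventually_elim (simp add: weight_sum_mult_step_prob i(1) path_weight_snoc mult.assoc)
  qed
  finally show ?case .
qed

lemma nn_integral_path_weight:
  assumes "i \<in> words k"
  shows "(\<integral>\<^sup>+ \<omega>. path_weight \<alpha> \<Psi> i \<omega> \<partial>M) = (\<Prod>r<k. \<integral>\<^sup>+ \<omega>. child_weight \<alpha> (\<psi> \<omega>) (i ! r) \<partial>M)"
  using assms
proof (induction k arbitrary: i)
  case 0
  then show ?case by (simp add: words_def path_weight_def emeasure_space_1)
next
  case (Suc k)
  obtain i' j where i: "i = i' @ [j]" "i' \<in> words k"
    using Suc.prems by (auto simp: words_Suc)
  have len: "length i' = k" and i'U: "i' \<in> lists {1..}" using i(2) by (auto simp: words_def)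
  have "(\<integral>\<^sup>+ \<omega>. path_weight \<alpha> \<Psi> i \<omega> \<partial>M) =
      (\<integral>\<^sup>+ \<omega>. path_weight \<alpha> \<Psi> i' \<omega> * child_weight \<alpha> (\<Psi> i' \<omega>) j \<partial>M)"
    by (simp add: i path_weight_snoc)
  also have "\<dots> = (\<integral>\<^sup>+ \<omega>. path_weight \<alpha> \<Psi> i' \<omega> \<partial>M) * (\<integral>\<^sup>+ \<omega>. child_weight \<alpha> (\<psi> \<omega>) j \<partial>M)"
  proof (rule nn_integral_mult_node[OF i'U, of "nodes_below k"])
    show "path_weight \<alpha> \<Psi> i' \<in> borel_measurable (mark_algebra (nodes_below k))"
      by (rule path_weight_measurable) (use take_nodes_below[OF i(2)] len in auto)
  qed (use len in auto)
  finally show ?case using Suc.IH[OF i(2)] len by (simp add: i nth_append)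
qed

section \<open>What the observed sigma-algebras see on the event that the spine is at a given node\<close>

lemma space_node_algebra [simp]: "space (node_algebra M \<Psi> i) = space M"
  by (simp add: node_algebra_def space_measure_of_conv)

lemma sets_node_algebra: "sets (node_algebra M \<Psi> i) = sigma_sets (space M)
     {{\<omega> \<in> space M. i \<in> generation \<Psi> (length i) \<omega> \<and> \<Psi> i \<omega> \<in> B} | B. B \<in> sets mark_space}"
  unfolding node_algebra_def by (rule sets_measure_of) auto

lemma node_algebra_event:
  "B \<in> sets mark_space \<Longrightarrow>
    {\<omega> \<in> space M. i \<in> generation \<Psi> (length i) \<omega> \<and> \<Psi> i \<omega> \<in> B} \<in> sets (node_algebra M \<Psi> i)"
  unfolding sets_node_algebra by blast

lemma sets_node_algebra_Pow: "sets (node_algebra M \<Psi> i) \<subseteq> Pow (space M)"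
  using sets.space_closed[of "node_algebra M \<Psi> i"] by simp

lemma space_F_alg [simp]: "space (F_alg M \<Psi> k) = space M"
  by (simp add: F_alg_def space_measure_of_conv)

lemma sets_F_alg:
  "sets (F_alg M \<Psi> k) = sigma_sets (space M) (\<Union>s<k. \<Union>i\<in>words s. sets (node_algebra M \<Psi> i))"
  unfolding F_alg_def by (intro sets_measure_of UN_least sets_node_algebra_Pow)

lemma space_G_alg [simp]: "space (G_alg M \<Psi> J k) = space M"
  by (simp add: G_alg_def space_measure_of_conv)

lemma sets_G_alg:
  "sets (G_alg M \<Psi> J k) = sigma_sets (space M) (sets (F_alg M \<Psi> k) \<union> (\<Union>s\<le>k. J_sets M J s))"
proof -
  have "sets (F_alg M \<Psi> k) \<subseteq> Pow (space M)" using sets.space_closed[of "F_alg M \<Psi> k"] by simp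
  then show ?thesis
    unfolding G_alg_def J_sets_def
    by (intro sets_measure_of Un_least UN_least sets_vimage_algebra_Pow)
qed

lemma node_algebra_subset_G_alg:
  assumes "i \<in> words s" "s < k"
  shows "sets (node_algebra M \<Psi> i) \<subseteq> sets (G_alg M \<Psi> J k)"
  using assms unfolding sets_G_alg sets_F_alg by (blast intro: sigma_sets.Basic)

lemma sets_G_alg_mono: "k \<le> l \<Longrightarrow> sets (G_alg M \<Psi> J k) \<subseteq> sets (G_alg M \<Psi> J l)"
  unfolding sets_G_alg sets_F_alg
  by (intro sigma_sets_mono' Un_mono UN_mono) auto

lemma J_event_G_alg: "s \<le> k \<Longrightarrow> {\<omega> \<in> space M. J s \<omega> \<in> X} \<in> sets (G_alg M \<Psi> J k)"
proof -
  assume "s \<le> k"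
  moreover have "{\<omega> \<in> space M. J s \<omega> \<in> X} = J s -` X \<inter> space M" by auto
  moreover have "J s -` X \<inter> space M \<in> J_sets M J s" by (auto simp: J_sets_iff)
  ultimately show ?thesis
    unfolding sets_G_alg by (auto intro!: sigma_sets.Basic)
qed

lemma generation_event_node_algebra:
  assumes "i \<in> words n"
  shows "{\<omega> \<in> space M. i \<in> generation \<Psi> n \<omega>} \<in> sets (node_algebra M \<Psi> i)"
proof -
  have "i \<in> lists {1..}" "length i = n" using assms by (auto simp: words_def)
  then have "{\<omega> \<in> space M. i \<in> generation \<Psi> n \<omega>} =
      {\<omega> \<in> space M. i \<in> generation \<Psi> (length i) \<omega> \<and> \<Psi> i \<omega> \<in> space mark_space}"
    using measurable_space[OF node_rv] by blast
  then show ?thesis using node_algebra_event[OF sets.top, of i] by simp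
qed

text \<open>
  Membership in $A_n$ is decided one generation earlier, by the number of children of the parent.
\<close>

lemma generation_event_G_alg:
  assumes "i \<in> words n"
  shows "{\<omega> \<in> space M. i \<in> generation \<Psi> n \<omega>} \<in> sets (G_alg M \<Psi> J n)"
proof (cases n)
  case 0
  with assms have "{\<omega> \<in> space M. i \<in> generation \<Psi> n \<omega>} = space M" by (auto simp: words_def)
  then show ?thesis using sets.top[of "G_alg M \<Psi> J n"] by simp
next
  case (Suc m)
  then obtain i' j where i: "i = i' @ [j]" "i' \<in> words m" "1 \<le> j"
    using assms by (auto simp: words_Suc)
  have "{x \<in> space mark_space. enat j \<le> mark_N x} \<in> sets mark_space" by measurable
  from node_algebra_event[OF this, of i']
  have "{\<omega> \<in> space M. i' \<in> generation \<Psi> (length i') \<omega> \<and> \<Psi> i' \<omega> \<in> {x \<in> space mark_space. enat j \<le> mark_N x}}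
    \<in> sets (G_alg M \<Psi> J n)"
    using node_algebra_subset_G_alg[OF i(2), of n] Suc by blast
  also have "{\<omega> \<in> space M. i' \<in> generation \<Psi> (length i') \<omega> \<and> \<Psi> i' \<omega> \<in> {x \<in> space mark_space. enat j \<le> mark_N x}} =
     {\<omega> \<in> space M. i \<in> generation \<Psi> n \<omega>}"
    using i Suc measurable_space[OF node_rv[of i']] by (auto simp: words_def)
  finally show ?thesis .
qed

lemma node_algebra_mark_algebra:
  assumes "i \<in> words s" "s < n"
  shows "sets (node_algebra M \<Psi> i) \<subseteq> sets (mark_algebra (nodes_below n))"
proof -
  have [measurable]: "\<Psi> i \<in> measurable (mark_algebra (nodes_below n)) mark_space"
    using assms by (intro node_measurable) (auto simp: words_def)
  have [measurable]: "Measurable.pred (mark_algebra (nodes_below n)) (\<lambda>\<omega>. i \<in> generation \<Psi> (length i) \<omega>)"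
    using assms by (intro pred_generation_mark_algebra) (auto simp: words_def dest: in_set_takeD)
  have "{\<omega> \<in> space M. i \<in> generation \<Psi> (length i) \<omega> \<and> \<Psi> i \<omega> \<in> B} \<in> sets (mark_algebra (nodes_below n))"
    if [measurable]: "B \<in> sets mark_space" for B
  proof -
    have "{\<omega> \<in> space (mark_algebra (nodes_below n)). i \<in> generation \<Psi> (length i) \<omega> \<and> \<Psi> i \<omega> \<in> B}
       \<in> sets (mark_algebra (nodes_below n))" by measurable
    then show ?thesis by simp
  qed
  then show ?thesis
    unfolding sets_node_algebra space_mark_algebra[of "nodes_below n", symmetric]
    by (intro sets.sigma_sets_subset) auto
qed

lemma F_alg_mark_algebra: "sets (F_alg M \<Psi> n) \<subseteq> sets (mark_algebra (nodes_below n))"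
  unfolding sets_F_alg space_mark_algebra[of "nodes_below n", symmetric]
  by (intro sets.sigma_sets_subset UN_least node_algebra_mark_algebra) auto

lemma sets_G_alg_events: "sets (G_alg M \<Psi> J k) \<subseteq> events"
  unfolding sets_G_alg
proof (intro sets.sigma_sets_subset Un_least UN_least)
  show "sets (F_alg M \<Psi> k) \<subseteq> events"
    by (rule order_trans[OF F_alg_mark_algebra sets_mark_algebra_events]) auto
  show "J_sets M J s \<subseteq> events" for s
    by (auto simp: J_sets_iff)
qed

text \<open>
  The node $i$ determines $J_0, \ldots, J_n$ on $\{J_n = i\}$, so the part of $\mathcal{G}_n$ that is
  generated by the spine becomes trivial there. The property passes through complements and
  countable unions.
\<close>

lemma G_alg_trace:
  assumes "A \<in> sets (G_alg M \<Psi> J n)"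
  shows "\<exists>A'\<in>sets (mark_algebra (nodes_below n)). \<forall>\<omega>\<in>space M. J n \<omega> = i \<longrightarrow> (\<omega> \<in> A \<longleftrightarrow> \<omega> \<in> A')"
  using assms unfolding sets_G_alg
proof (induction rule: sigma_sets.induct)
  case (Basic A)
  then consider "A \<in> sets (F_alg M \<Psi> n)" | s X where "s \<le> n" "A = J s -` X \<inter> space M"
    by (auto simp: J_sets_iff)
  then show ?case
  proof cases
    case 1
    then show ?thesis using F_alg_mark_algebra by blast
  next
    case 2
    have "space M \<in> sets (mark_algebra (nodes_below n))"
      using sets.top[of "mark_algebra (nodes_below n)"] by simp
    then show ?thesis using 2 J_prefix
      by (intro bexI[of _ "if take s i \<in> X then space M else {}"]) (auto split: if_splits)
  qed
next
  case Empty
  then show ?case by blast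
next
  case (Compl A)
  then obtain A' where A': "A' \<in> sets (mark_algebra (nodes_below n))"
    "\<forall>\<omega>\<in>space M. J n \<omega> = i \<longrightarrow> (\<omega> \<in> A \<longleftrightarrow> \<omega> \<in> A')" by blast
  then have "space M - A' \<in> sets (mark_algebra (nodes_below n))"
    using sets.compl_sets[OF A'(1)] by simp
  with A'(2) show ?case by (intro bexI[of _ "space M - A'"]) auto
next
  case (Union a)
  then obtain a' where "\<And>m::nat. a' m \<in> sets (mark_algebra (nodes_below n))"
    "\<And>m \<omega>. \<omega> \<in> space M \<Longrightarrow> J n \<omega> = i \<Longrightarrow> \<omega> \<in> a m \<longleftrightarrow> \<omega> \<in> a' m" by metis
  then show ?case by (intro bexI[of _ "\<Union>m. a' m"]) auto
qed

lemma J_event_eq_G_alg: "{\<omega> \<in> space M. J n \<omega> = j} \<in> sets (G_alg M \<Psi> J n)"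
  using J_event_G_alg[of n n "{j}"] by simp

text \<open>
  These are the general elements of the sigma-algebra of the node \<open>j\<close> of generation \<open>n\<close>: on
  the event that \<open>j\<close> is not alive, the sigma-algebra distinguishes nothing, and the Boolean tells
  whether this event is included.
\<close>

definition node_event :: "nat \<Rightarrow> nat list \<Rightarrow> mark set \<Rightarrow> bool \<Rightarrow> 'a set" where
  "node_event n j B b = {\<omega> \<in> space M. if j \<in> generation \<Psi> n \<omega> then \<Psi> j \<omega> \<in> B else b}"

text \<open>
  The conditional probability of \<^term>\<open>node_event n j B b\<close> given $\mathcal{G}_n$ under the tilted
  measure.
\<close>

definition node_law :: "nat \<Rightarrow> nat list \<Rightarrow> mark set \<Rightarrow> bool \<Rightarrow> 'a \<Rightarrow> ennreal" where
  "node_law n j B b \<omega> =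
     (if j = J n \<omega> then \<integral>\<^sup>+ \<omega>'. indicator B (\<psi> \<omega>') * weight_sum \<alpha> (\<psi> \<omega>') \<partial>M
      else if j \<in> generation \<Psi> n \<omega> then \<integral>\<^sup>+ \<omega>'. indicator B (\<psi> \<omega>') \<partial>M
      else of_bool b)"

lemma node_event_node_algebra:
  assumes "j \<in> words n" "B \<in> sets mark_space"
  shows "node_event n j B b \<in> sets (node_algebra M \<Psi> j)"
proof -
  have len: "length j = n" using assms by (simp add: words_def)
  have gen: "{\<omega> \<in> space M. j \<in> generation \<Psi> n \<omega>} \<in> sets (node_algebra M \<Psi> j)"
    by (rule generation_event_node_algebra[OF assms(1)])
  have "node_event n j B b = {\<omega> \<in> space M. j \<in> generation \<Psi> (length j) \<omega> \<and> \<Psi> j \<omega> \<in> B} \<union>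
      (if b then space (node_algebra M \<Psi> j) - {\<omega> \<in> space M. j \<in> generation \<Psi> n \<omega>} else {})"
    by (auto simp: node_event_def len)
  also have "\<dots> \<in> sets (node_algebra M \<Psi> j)"
    using node_algebra_event[OF assms(2), of j] gen sets.compl_sets[OF gen] by (auto simp del: space_node_algebra)
  finally show ?thesis .
qed

lemma node_algebra_cases:
  assumes "A \<in> sets (node_algebra M \<Psi> j)" "j \<in> words n"
  shows "\<exists>B b. B \<in> sets mark_space \<and> A = node_event n j B b"
  using assms(1) unfolding sets_node_algebra
proof (induction rule: sigma_sets.induct)
  case (Basic A)
  then obtain B where "B \<in> sets mark_space" "A = {\<omega> \<in> space M. j \<in> generation \<Psi> n \<omega> \<and> \<Psi> j \<omega> \<in> B}"
    using assms(2) by (auto simp: words_def)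
  then show ?case by (intro exI[of _ B] exI[of _ False]) (auto simp: node_event_def)
next
  case Empty
  show ?case by (intro exI[of _ "{}"] exI[of _ False]) (auto simp: node_event_def)
next
  case (Compl A)
  then obtain B b where "B \<in> sets mark_space" "A = node_event n j B b" by blast
  moreover have "j \<in> lists {1..}" using assms(2) by (auto simp: words_def)
  ultimately show ?case
    using measurable_space[OF node_rv[of j]]
    by (intro exI[of _ "space mark_space - B"] exI[of _ "\<not> b"]) (auto simp: node_event_def)
next
  case (Union a)
  then obtain B b where "\<And>m::nat. B m \<in> sets mark_space" and a: "\<And>m. a m = node_event n j (B m) (b m)"
    by metis
  then have "(\<Union>m. B m) \<in> sets mark_space" by auto
  moreover have "(\<Union>m. a m) = node_event n j (\<Union>m. B m) (\<exists>m. b m)"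
    unfolding a node_event_def by (auto split: if_splits)
  ultimately show ?case by blast
qed

lemma node_law_measurable:
  assumes G: "space G = space M" "{\<omega> \<in> space M. J n \<omega> = j} \<in> sets G"
    "{\<omega> \<in> space M. j \<in> generation \<Psi> n \<omega>} \<in> sets G"
  shows "node_law n j B b \<in> borel_measurable G"
proof -
  have [measurable]: "Measurable.pred G (\<lambda>\<omega>. j = J n \<omega>)" "Measurable.pred G (\<lambda>\<omega>. j \<in> generation \<Psi> n \<omega>)"
    unfolding pred_def using G by (simp_all add: eq_commute)
  show ?thesis unfolding node_law_def[abs_def] by measurable
qed

lemma node_law_le_1: "node_law n j B b \<omega> \<le> 1"
proof -
  have "(\<integral>\<^sup>+ \<omega>'. indicator B (\<psi> \<omega>') * weight_sum \<alpha> (\<psi> \<omega>') \<partial>M) \<le> (\<integral>\<^sup>+ \<omega>'. weight_sum \<alpha> (\<psi> \<omega>') \<partial>M)"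
    by (intro nn_integral_mono) (auto split: split_indicator)
  moreover have "(\<integral>\<^sup>+ \<omega>'. indicator B (\<psi> \<omega>') \<partial>M) \<le> (\<integral>\<^sup>+ \<omega>'. 1 \<partial>M)"
    by (intro nn_integral_mono) (auto split: split_indicator)
  ultimately show ?thesis
    by (auto simp: node_law_def mean_weight_sum emeasure_space_1)
qed

end

section \<open>The tilted law of the marks in one generation\<close>

locale tilted_branching_spine = branching_spine M \<psi> \<Psi> \<alpha> J for M :: "'a measure" and \<psi> \<Psi> \<alpha> J +
  fixes Pt :: "'a measure"
  assumes tilted: "tilted_measure M \<alpha> \<Psi> J Pt"
begin

lemma space_Pt [simp]: "space Pt = space M"
  using tilted by (simp add: tilted_measure_def)

lemma emeasure_Pt:
  "A \<in> sets (G_alg M \<Psi> J k) \<Longrightarrow> emeasure Pt A = (\<integral>\<^sup>+ \<omega>. indicator A \<omega> * likelihood \<alpha> \<Psi> J k \<omega> \<partial>M)"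
  using tilted by (auto simp: tilted_measure_def)

lemma sets_G_alg_Pt: "sets (G_alg M \<Psi> J k) \<subseteq> sets Pt"
  using tilted by (auto simp: tilted_measure_def)

lemma prob_space_Pt: "prob_space Pt"
proof
  have "space M \<in> sets (G_alg M \<Psi> J 0)" using sets.top[of "G_alg M \<Psi> J 0"] by simp
  from emeasure_Pt[OF this] have "emeasure Pt (space M) = (\<integral>\<^sup>+ \<omega>. indicator (space M) \<omega> \<partial>M)"
    by (simp add: likelihood_def)
  then show "emeasure Pt (space Pt) = 1" by (simp add: emeasure_space_1)
qed

lemma subalgebra_Pt_G_alg: "subalgebra Pt (G_alg M \<Psi> J n)"
  by (simp add: subalgebra_def sets_G_alg_Pt)

text \<open>
  On $\mathcal{G}_n$ the tilted measure has the density $L_n$. As only events of $\mathcal{G}_n$ are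
  compared, it suffices that $L_n$ is a random variable on the whole space.
\<close>

lemma nn_integral_Pt:
  assumes f: "f \<in> borel_measurable (G_alg M \<Psi> J n)"
  shows "(\<integral>\<^sup>+ \<omega>. f \<omega> \<partial>Pt) = (\<integral>\<^sup>+ \<omega>. f \<omega> * likelihood \<alpha> \<Psi> J n \<omega> \<partial>M)"
proof -
  let ?D = "density M (likelihood \<alpha> \<Psi> J n)" and ?G = "G_alg M \<Psi> J n"
  have sub: "subalgebra ?D ?G" and subM: "subalgebra M ?G"
    by (simp_all add: subalgebra_def sets_G_alg_events)
  have "restr_to_subalg Pt ?G = restr_to_subalg ?D ?G"
  proof (rule measure_eqI)
    show "sets (restr_to_subalg Pt ?G) = sets (restr_to_subalg ?D ?G)"
      by (simp add: sets_restr_to_subalg sub subalgebra_Pt_G_alg)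
    fix A assume "A \<in> sets (restr_to_subalg Pt ?G)"
    then have A: "A \<in> sets ?G" by (simp add: sets_restr_to_subalg subalgebra_Pt_G_alg)
    moreover have "A \<in> events" using A sets_G_alg_events by blast
    ultimately show "emeasure (restr_to_subalg Pt ?G) A = emeasure (restr_to_subalg ?D ?G) A"
      by (simp add: emeasure_restr_to_subalg sub subalgebra_Pt_G_alg emeasure_Pt emeasure_density mult.commute)
  qed
  then have "(\<integral>\<^sup>+ \<omega>. f \<omega> \<partial>Pt) = (\<integral>\<^sup>+ \<omega>. f \<omega> \<partial>?D)"
    using nn_integral_subalgebra2[OF sub f] nn_integral_subalgebra2[OF subalgebra_Pt_G_alg f] by simp
  also have "\<dots> = (\<integral>\<^sup>+ \<omega>. likelihood \<alpha> \<Psi> J n \<omega> * f \<omega> \<partial>M)"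
    using measurable_from_subalg[OF subM f] by (intro nn_integral_density) auto
  finally show ?thesis by (simp add: mult.commute)
qed

text \<open>
  The event on the left belongs to $\mathcal{G}_{n+1}$ and the integrand on the right is
  $\mathcal{G}_n$-measurable, so both sides are integrals under the original measure, with
  densities $L_{n+1}$ and $L_n$. They are compared on each of the events $\{J_n = i\}$: the
  likelihood is traded for the path weight, the marks of generation $n$ are integrated out, and the
  likelihood is restored.
\<close>

lemma emeasure_Pt_node_events:
  assumes A: "A \<in> sets (G_alg M \<Psi> J n)" and S: "finite S" "S \<subseteq> words n"
    and B: "\<And>j. j \<in> S \<Longrightarrow> B j \<in> sets mark_space"
  shows "emeasure Pt {\<omega> \<in> A. \<forall>j\<in>S. \<omega> \<in> node_event n j (B j) (b j)} =
    (\<integral>\<^sup>+ \<omega>. indicator A \<omega> * (\<Prod>j\<in>S. node_law n j (B j) (b j) \<omega>) \<partial>Pt)"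
proof -
  let ?L = "likelihood \<alpha> \<Psi> J" and ?U = "lists {1..} :: nat list set"
  define E where "E = {\<omega> \<in> A. \<forall>j\<in>S. \<omega> \<in> node_event n j (B j) (b j)}"
  have AM: "A \<subseteq> space M" using sets.sets_into_space[OF A] by simp
  have E: "E \<in> sets (G_alg M \<Psi> J (Suc n))"
  proof -
    have "node_event n j (B j) (b j) \<in> sets (G_alg M \<Psi> J (Suc n))" if "j \<in> S" for j
      using node_event_node_algebra[of j n "B j" "b j"] node_algebra_subset_G_alg[of j n "Suc n"] that S B
      by blast
    moreover have "A \<in> sets (G_alg M \<Psi> J (Suc n))" using A sets_G_alg_mono[of n "Suc n"] by auto
    moreover have "E = (if S = {} then A else A \<inter> (\<Inter>j\<in>S. node_event n j (B j) (b j)))"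
      by (auto simp: E_def)
    ultimately show ?thesis using S by (auto intro!: sets.Int sets.finite_INT)
  qed
  have law: "node_law n j (B j) (b j) \<in> borel_measurable (G_alg M \<Psi> J n)" if "j \<in> words n" for j
    using J_event_G_alg[of n n "{j}"] generation_event_G_alg[OF that] by (intro node_law_measurable) auto
  have Alaw: "(\<lambda>\<omega>. indicator A \<omega> * (\<Prod>j\<in>S. node_law n j (B j) (b j) \<omega>)) \<in> borel_measurable (G_alg M \<Psi> J n)"
    using A S law by (intro borel_measurable_times_ennreal borel_measurable_prod_ennreal) auto
  have "emeasure Pt E = (\<integral>\<^sup>+ \<omega>. indicator E \<omega> * ?L (Suc n) \<omega> \<partial>M)"
    by (rule emeasure_Pt[OF E])
  also have "\<dots> = (\<integral>\<^sup>+ \<omega>. indicator A \<omega> * (\<Prod>j\<in>S. node_law n j (B j) (b j) \<omega>) * ?L n \<omega> \<partial>M)"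
  proof (rule nn_integral_cong_on_spine[of _ _ n])
    show "(\<lambda>\<omega>. indicator E \<omega> * ?L (Suc n) \<omega>) \<in> borel_measurable M"
      using subsetD[OF sets_G_alg_events E] by (intro borel_measurable_times_ennreal) auto
    show "(\<lambda>\<omega>. indicator A \<omega> * (\<Prod>j\<in>S. node_law n j (B j) (b j) \<omega>) * ?L n \<omega>) \<in> borel_measurable M"
      using measurable_from_subalg[OF _ Alaw, of M] sets_G_alg_events
      by (intro borel_measurable_times_ennreal[OF _ likelihood_rv]) (auto simp: subalgebra_def)
    fix i assume i: "i \<in> words n"
    then have iU: "i \<in> ?U" "length i = n" by (auto simp: words_def)
    obtain A' where A': "A' \<in> sets (mark_algebra (nodes_below n))"
      and AA': "\<And>\<omega>. \<omega> \<in> space M \<Longrightarrow> J n \<omega> = i \<Longrightarrow> \<omega> \<in> A \<longleftrightarrow> \<omega> \<in> A'"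
      using G_alg_trace[OF A, of i] by blast
    define f where "f j \<omega> = (if j \<in> generation \<Psi> n \<omega> then indicator (B j) (\<Psi> j \<omega>) else of_bool (b j) :: ennreal)" for j \<omega>
    define m where "m j \<omega> =
      (if j = i then \<integral>\<^sup>+ \<omega>'. indicator (B j) (\<psi> \<omega>') * weight_sum \<alpha> (\<psi> \<omega>') \<partial>M
       else if j \<in> generation \<Psi> n \<omega> then \<integral>\<^sup>+ \<omega>'. indicator (B j) (\<psi> \<omega>') \<partial>M
       else of_bool (b j))" for j \<omega>
    \<comment> \<open>The spine node \<open>i\<close> may or may not belong to \<open>S\<close>. Giving it the factor \<open>weight_sum \<alpha>\<close> and
      the nodes outside \<open>S\<close> no constraint lets one product over \<open>insert i S\<close> serve both cases; if
      \<open>i\<close> is outside \<open>S\<close>, its factor has mean 1.\<close>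
    define g where "g j x = (if j = i then weight_sum \<alpha> x else 1) * (if j \<in> S then indicator (B j) x else 1)" for j x
    define c where "c j = (if j \<in> S then of_bool (b j) else 1 :: ennreal)" for j
    have g: "g j \<in> borel_measurable mark_space" for j
      using B by (cases "j \<in> S") (auto simp: g_def[abs_def])
    have A'U: "A' \<in> sets (mark_algebra ?U)"
      using A' sets_mark_algebra_mono[of "nodes_below n" ?U] by auto
    have gen: "Measurable.pred (mark_algebra ?U) (\<lambda>\<omega>. j \<in> generation \<Psi> n \<omega>)" if "j \<in> words n" for j
      using take_nodes_below[OF that] by (intro pred_generation_mark_algebra) auto
    have f: "f j \<in> borel_measurable (mark_algebra ?U)" if "j \<in> S" for j
    proof -
      have jU: "j \<in> ?U" using that S by (auto simp: words_def)
      note gen[OF subsetD[OF S(2) that], measurable] node_measurable[OF jU jU, measurable] B[OF that, measurable]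
      show ?thesis unfolding f_def[abs_def] by measurable
    qed
    have m: "m j \<in> borel_measurable (mark_algebra ?U)" if "j \<in> S" for j
    proof -
      note gen[OF subsetD[OF S(2) that], measurable]
      show ?thesis unfolding m_def[abs_def] by measurable
    qed
    have "(\<integral>\<^sup>+ \<omega>. indicator {\<omega>. J n \<omega> = i} \<omega> * (indicator E \<omega> * ?L (Suc n) \<omega>) \<partial>M) =
      (\<integral>\<^sup>+ \<omega>. indicator {\<omega>. J n \<omega> = i} \<omega> * (?L n \<omega> * (indicator A' \<omega> * weight_sum \<alpha> (\<Psi> i \<omega>) * (\<Prod>j\<in>S. f j \<omega>))) \<partial>M)"
    proof (intro nn_integral_cong)
      fix \<omega> assume \<omega>: "\<omega> \<in> space M"
      have "indicator E \<omega> = indicator A \<omega> * (\<Prod>j\<in>S. f j \<omega>)"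
      proof -
        have "f j \<omega> = indicator (node_event n j (B j) (b j)) \<omega>" for j
          using \<omega> by (auto simp: f_def node_event_def split: split_indicator)
        then show ?thesis using S(1)
          by (auto simp: E_def prod_zero_iff split: split_indicator)
      qed
      moreover have "?L (Suc n) \<omega> = ?L n \<omega> * weight_sum \<alpha> (\<Psi> (J n \<omega>) \<omega>)" by (simp add: likelihood_def)
      ultimately show "indicator {\<omega>. J n \<omega> = i} \<omega> * (indicator E \<omega> * ?L (Suc n) \<omega>) =
        indicator {\<omega>. J n \<omega> = i} \<omega> * (?L n \<omega> * (indicator A' \<omega> * weight_sum \<alpha> (\<Psi> i \<omega>) * (\<Prod>j\<in>S. f j \<omega>)))"
        using AA'[OF \<omega>] by (auto simp: mult_ac split: split_indicator)
    qed
    also have "\<dots> = (\<integral>\<^sup>+ \<omega>. path_weight \<alpha> \<Psi> i \<omega> * (indicator A' \<omega> * weight_sum \<alpha> (\<Psi> i \<omega>) * (\<Prod>j\<in>S. f j \<omega>)) \<partial>M)"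
      using A'U f S node_measurable[OF iU(1) iU(1)]
      by (intro nn_integral_likelihood_on_spine[OF i] borel_measurable_times_ennreal borel_measurable_prod_ennreal
           measurable_compose[OF _ weight_sum_measurable]) auto
    also have "\<dots> = (\<integral>\<^sup>+ \<omega>. (path_weight \<alpha> \<Psi> i \<omega> * indicator A' \<omega>) *
        (\<Prod>j\<in>insert i S. if j \<in> generation \<Psi> n \<omega> then g j (\<Psi> j \<omega>) else c j) \<partial>M)"
    proof (intro nn_integral_cong)
      fix \<omega>
      show "path_weight \<alpha> \<Psi> i \<omega> * (indicator A' \<omega> * weight_sum \<alpha> (\<Psi> i \<omega>) * (\<Prod>j\<in>S. f j \<omega>)) =
        (path_weight \<alpha> \<Psi> i \<omega> * indicator A' \<omega>) *
        (\<Prod>j\<in>insert i S. if j \<in> generation \<Psi> n \<omega> then g j (\<Psi> j \<omega>) else c j)"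
      proof (cases "i \<in> generation \<Psi> n \<omega>")
        case True
        have "(\<Prod>j\<in>insert i S. if j \<in> generation \<Psi> n \<omega> then g j (\<Psi> j \<omega>) else c j) =
           (\<Prod>j\<in>insert i S. (if j = i then weight_sum \<alpha> (\<Psi> i \<omega>) else 1) * (if j \<in> S then f j \<omega> else 1))"
          using True by (intro prod.cong) (auto simp: g_def c_def f_def)
        also have "\<dots> = weight_sum \<alpha> (\<Psi> i \<omega>) * (\<Prod>j\<in>S. f j \<omega>)"
        proof -
          have "(\<Prod>j\<in>insert i S. if j \<in> S then f j \<omega> else 1) = (\<Prod>j\<in>S. f j \<omega>)"
            using S(1) by (intro prod.mono_neutral_cong_right) auto
          then show ?thesis using S(1) by (simp add: prod.distrib prod.delta)
        qed
        finally show ?thesis by (simp add: mult_ac)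
      next
        case False
        then show ?thesis using path_weight_eq_0[of i \<Psi> \<omega>] iU(2) by simp
      qed
    qed
    also have "\<dots> = (\<integral>\<^sup>+ \<omega>. (path_weight \<alpha> \<Psi> i \<omega> * indicator A' \<omega>) *
        (\<Prod>j\<in>insert i S. if j \<in> generation \<Psi> n \<omega> then \<integral>\<^sup>+ \<omega>. g j (\<psi> \<omega>) \<partial>M else c j) \<partial>M)"
    proof (rule nn_integral_resample_generation[where I = "nodes_below n"])
      show "(\<lambda>\<omega>. path_weight \<alpha> \<Psi> i \<omega> * indicator A' \<omega>) \<in> borel_measurable (mark_algebra (nodes_below n))"
        using A' take_nodes_below[OF i] iU by (intro borel_measurable_times_ennreal path_weight_measurable) auto
    qed (use S i g in \<open>auto simp: words_def\<close>)
    also have "\<dots> = (\<integral>\<^sup>+ \<omega>. path_weight \<alpha> \<Psi> i \<omega> * (indicator A' \<omega> * (\<Prod>j\<in>S. m j \<omega>)) \<partial>M)"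
    proof (intro nn_integral_cong)
      fix \<omega>
      show "(path_weight \<alpha> \<Psi> i \<omega> * indicator A' \<omega>) *
        (\<Prod>j\<in>insert i S. if j \<in> generation \<Psi> n \<omega> then \<integral>\<^sup>+ \<omega>. g j (\<psi> \<omega>) \<partial>M else c j) =
        path_weight \<alpha> \<Psi> i \<omega> * (indicator A' \<omega> * (\<Prod>j\<in>S. m j \<omega>))"
      proof (cases "i \<in> generation \<Psi> n \<omega>")
        case True
        have "(\<Prod>j\<in>insert i S. if j \<in> generation \<Psi> n \<omega> then \<integral>\<^sup>+ \<omega>. g j (\<psi> \<omega>) \<partial>M else c j) = (\<Prod>j\<in>S. m j \<omega>)"
          using S(1) True mean_weight_sum
          by (intro prod.mono_neutral_cong_right) (auto simp: g_def c_def m_def mult.commute)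
        then show ?thesis by (simp add: mult_ac)
      next
        case False
        then show ?thesis using path_weight_eq_0[of i \<Psi> \<omega>] iU(2) by simp
      qed
    qed
    also have "\<dots> = (\<integral>\<^sup>+ \<omega>. indicator {\<omega>. J n \<omega> = i} \<omega> * (?L n \<omega> * (indicator A' \<omega> * (\<Prod>j\<in>S. m j \<omega>))) \<partial>M)"
      using A'U m S
      by (intro nn_integral_likelihood_on_spine[OF i, symmetric] borel_measurable_times_ennreal borel_measurable_prod_ennreal) auto
    also have "\<dots> = (\<integral>\<^sup>+ \<omega>. indicator {\<omega>. J n \<omega> = i} \<omega> *
        (indicator A \<omega> * (\<Prod>j\<in>S. node_law n j (B j) (b j) \<omega>) * ?L n \<omega>) \<partial>M)"
      using AA' by (intro nn_integral_cong) (auto simp: m_def node_law_def mult_ac split: split_indicator)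
    finally show "(\<integral>\<^sup>+ \<omega>. indicator {\<omega>. J n \<omega> = i} \<omega> * (indicator E \<omega> * ?L (Suc n) \<omega>) \<partial>M) =
      (\<integral>\<^sup>+ \<omega>. indicator {\<omega>. J n \<omega> = i} \<omega> *
        (indicator A \<omega> * (\<Prod>j\<in>S. node_law n j (B j) (b j) \<omega>) * ?L n \<omega>) \<partial>M)" .
  qed
  also have "\<dots> = (\<integral>\<^sup>+ \<omega>. indicator A \<omega> * (\<Prod>j\<in>S. node_law n j (B j) (b j) \<omega>) \<partial>Pt)"
    by (rule nn_integral_Pt[OF Alaw, symmetric])
  finally show ?thesis unfolding E_def .
qed

text \<open>
  The product on the right depends on $\omega$ only through $A_n$ and $J_n$. Hence it is measurable
  already for a sigma-algebra that contains the corresponding events, and being the conditional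
  probability given $\mathcal{G}_n$, it is also the one given that smaller sigma-algebra.
\<close>

lemma AE_real_cond_exp_node_events:
  assumes H: "space H = space M" "sets H \<subseteq> sets (G_alg M \<Psi> J n)"
    and HJ: "\<And>j. j \<in> words n \<Longrightarrow> {\<omega> \<in> space M. J n \<omega> = j} \<in> sets H"
    and Hgen: "\<And>j. j \<in> words n \<Longrightarrow> {\<omega> \<in> space M. j \<in> generation \<Psi> n \<omega>} \<in> sets H"
    and S: "finite S" "S \<subseteq> words n" and B: "\<And>j. j \<in> S \<Longrightarrow> B j \<in> sets mark_space"
  shows "AE \<omega> in Pt. real_cond_exp Pt H (indicator {\<omega> \<in> space M. \<forall>j\<in>S. \<omega> \<in> node_event n j (B j) (b j)}) \<omega> =
    (\<Prod>j\<in>S. enn2real (node_law n j (B j) (b j) \<omega>))"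
proof -
  interpret Pt: prob_space Pt by (rule prob_space_Pt)
  have sub: "subalgebra Pt H"
    using H sets_G_alg_Pt[of n] by (auto simp: subalgebra_def)
  interpret cond: finite_measure_subalgebra Pt H
    by unfold_locales (rule sub)
  define E where "E = {\<omega> \<in> space M. \<forall>j\<in>S. \<omega> \<in> node_event n j (B j) (b j)}"
  define law where "law j = node_law n j (B j) (b j)" for j
  define r where "r \<omega> = (\<Prod>j\<in>S. enn2real (law j \<omega>))" for \<omega>
  have law_le: "law j \<omega> \<le> 1" for j \<omega> unfolding law_def by (rule node_law_le_1)
  have ennreal_law: "ennreal (enn2real (law j \<omega>)) = law j \<omega>" for j \<omega>
    using law_le[of j \<omega>] by (intro ennreal_enn2real) (auto intro: le_less_trans)
  have r_nonneg: "0 \<le> r \<omega>" for \<omega> by (simp add: r_def prod_nonneg)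
  have ennreal_r: "ennreal (r \<omega>) = (\<Prod>j\<in>S. law j \<omega>)" for \<omega>
    by (simp add: r_def prod_ennreal[symmetric] ennreal_law)
  have r_le: "r \<omega> \<le> 1" for \<omega>
    using law_le by (auto simp: r_def intro!: prod_le_1 enn2real_leI)
  have law: "law j \<in> borel_measurable H" if "j \<in> S" for j
    unfolding law_def using that S H HJ Hgen by (intro node_law_measurable) auto
  have rH: "r \<in> borel_measurable H"
    unfolding r_def[abs_def] using law by measurable
  then have [measurable]: "r \<in> borel_measurable Pt" by (rule measurable_from_subalg[OF sub])
  have E: "E \<in> sets Pt"
  proof -
    have "node_event n j (B j) (b j) \<in> sets Pt" if "j \<in> S" for j
      using node_event_node_algebra[of j n "B j" "b j"] node_algebra_subset_G_alg[of j n "Suc n"] that S B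
        sets_G_alg_Pt[of "Suc n"] by blast
    moreover have "E = (if S = {} then space Pt else space Pt \<inter> (\<Inter>j\<in>S. node_event n j (B j) (b j)))"
      by (auto simp: E_def)
    moreover have "space Pt \<in> sets Pt" by (rule sets.top)
    ultimately show ?thesis using S by (auto simp del: space_Pt intro!: sets.Int sets.finite_INT)
  qed
  have "AE \<omega> in Pt. real_cond_exp Pt H (indicator E) \<omega> = r \<omega>"
  proof (rule cond.real_cond_exp_charact)
    show "integrable Pt (indicator E :: 'a \<Rightarrow> real)"
      using E by (simp add: Pt.emeasure_eq_measure)
    show "integrable Pt r"
      by (rule Pt.integrable_const_bound[of _ 1]) (use r_nonneg r_le in auto)
    show "r \<in> borel_measurable H" by (rule rH)
    fix A assume AH: "A \<in> sets H"
    then have A: "A \<in> sets (G_alg M \<Psi> J n)" using H by auto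
    then have APt [measurable]: "A \<in> sets Pt" using sets_G_alg_Pt by blast
    have AM: "A \<subseteq> space M" using sets.sets_into_space[OF A] by simp
    have "(LINT \<omega>:A|Pt. indicator E \<omega>) = enn2real (\<integral>\<^sup>+ \<omega>. ennreal (indicator A \<omega> *\<^sub>R indicator E \<omega>) \<partial>Pt)"
      unfolding set_lebesgue_integral_def using E by (intro integral_eq_nn_integral) auto
    also have "(\<integral>\<^sup>+ \<omega>. ennreal (indicator A \<omega> *\<^sub>R indicator E \<omega>) \<partial>Pt) = (\<integral>\<^sup>+ \<omega>. indicator (A \<inter> E) \<omega> \<partial>Pt)"
      by (intro nn_integral_cong) (auto split: split_indicator)
    also have "\<dots> = emeasure Pt (A \<inter> E)" using E APt by simp
    also have "A \<inter> E = {\<omega> \<in> A. \<forall>j\<in>S. \<omega> \<in> node_event n j (B j) (b j)}"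
      using AM by (auto simp: E_def)
    also have "emeasure Pt \<dots> = (\<integral>\<^sup>+ \<omega>. indicator A \<omega> * (\<Prod>j\<in>S. law j \<omega>) \<partial>Pt)"
      unfolding law_def by (rule emeasure_Pt_node_events[OF A S B])
    also have "\<dots> = (\<integral>\<^sup>+ \<omega>. ennreal (indicator A \<omega> *\<^sub>R r \<omega>) \<partial>Pt)"
      by (intro nn_integral_cong) (auto simp: ennreal_r split: split_indicator)
    also have "enn2real \<dots> = (LINT \<omega>:A|Pt. r \<omega>)"
      unfolding set_lebesgue_integral_def using r_nonneg by (intro integral_eq_nn_integral[symmetric]) auto
    finally show "(LINT \<omega>:A|Pt. indicator E \<omega>) = (LINT \<omega>:A|Pt. r \<omega>)" .
  qed
  then show ?thesis unfolding E_def r_def law_def .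
qed

lemma cond_indep_node_algebras:
  assumes H: "space H = space M" "sets H \<subseteq> sets (G_alg M \<Psi> J n)"
    and HJ: "\<And>j. j \<in> words n \<Longrightarrow> {\<omega> \<in> space M. J n \<omega> = j} \<in> sets H"
    and Hgen: "\<And>j. j \<in> words n \<Longrightarrow> {\<omega> \<in> space M. j \<in> generation \<Psi> n \<omega>} \<in> sets H"
  shows "cond_indep_sets Pt H (\<lambda>j. sets (node_algebra M \<Psi> j)) (words n)"
proof -
  have sub: "subalgebra Pt H"
    using H sets_G_alg_Pt[of n] by (auto simp: subalgebra_def)
  have events: "sets (node_algebra M \<Psi> j) \<subseteq> sets Pt" if "j \<in> words n" for j
    using node_algebra_subset_G_alg[OF that, of "Suc n"] sets_G_alg_Pt[of "Suc n"] by blast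
  have indep: "AE \<omega> in Pt. real_cond_exp Pt H (indicator (\<Inter>j\<in>S. A j)) \<omega> =
      (\<Prod>j\<in>S. real_cond_exp Pt H (indicator (A j)) \<omega>)"
    if S: "S \<subseteq> words n" "S \<noteq> {}" "finite S" and A: "A \<in> (\<Pi> j\<in>S. sets (node_algebra M \<Psi> j))" for S A
  proof -
  have "\<forall>j\<in>S. \<exists>B b. B \<in> sets mark_space \<and> A j = node_event n j B b"
    using A S by (intro ballI node_algebra_cases) auto
  then obtain B b where B: "\<And>j. j \<in> S \<Longrightarrow> B j \<in> sets mark_space"
    and AB: "\<And>j. j \<in> S \<Longrightarrow> A j = node_event n j (B j) (b j)" by metis
  have single: "AE \<omega> in Pt. \<forall>j\<in>S. real_cond_exp Pt H (indicator (A j)) \<omega> = enn2real (node_law n j (B j) (b j) \<omega>)"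
  proof (rule AE_finite_allI[OF S(3)])
    fix j assume j: "j \<in> S"
    have "AE \<omega> in Pt. real_cond_exp Pt H
        (indicator {\<omega> \<in> space M. \<forall>j\<in>{j}. \<omega> \<in> node_event n j (B j) (b j)}) \<omega> =
      (\<Prod>j\<in>{j}. enn2real (node_law n j (B j) (b j) \<omega>))"
      by (rule AE_real_cond_exp_node_events[OF H HJ Hgen]) (use j S B in auto)
    moreover have "{\<omega> \<in> space M. \<forall>j\<in>{j}. \<omega> \<in> node_event n j (B j) (b j)} = A j"
      by (simp add: AB[OF j] node_event_def)
    ultimately show "AE \<omega> in Pt. real_cond_exp Pt H (indicator (A j)) \<omega> = enn2real (node_law n j (B j) (b j) \<omega>)"
      by simp
  qed
  have joint: "AE \<omega> in Pt. real_cond_exp Pt H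
      (indicator {\<omega> \<in> space M. \<forall>j\<in>S. \<omega> \<in> node_event n j (B j) (b j)}) \<omega> =
    (\<Prod>j\<in>S. enn2real (node_law n j (B j) (b j) \<omega>))"
    by (rule AE_real_cond_exp_node_events[OF H HJ Hgen]) (use S B in auto)
  have Inter: "{\<omega> \<in> space M. \<forall>j\<in>S. \<omega> \<in> node_event n j (B j) (b j)} = (\<Inter>j\<in>S. A j)"
  proof -
    have "(\<Inter>j\<in>S. A j) = (\<Inter>j\<in>S. node_event n j (B j) (b j))"
      using AB by (rule INF_cong[OF refl])
    then show ?thesis using S(2) unfolding node_event_def by blast
  qed
  from single joint[unfolded Inter] show ?thesis
    by eventually_elim simp
  qed
  show ?thesis
    unfolding cond_indep_sets_def by (intro conjI ballI allI impI sub events indep)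
qed

lemma cond_indep_G_alg:
  "cond_indep_sets Pt (G_alg M \<Psi> J n) (\<lambda>j. sets (node_algebra M \<Psi> j)) (words n)"
  by (rule cond_indep_node_algebras) (auto intro: J_event_eq_G_alg generation_event_G_alg)

lemma cond_indep_G_pre_alg:
  "cond_indep_sets Pt (G_pre_alg M \<Psi> J n) (\<lambda>j. sets (node_algebra M \<Psi> j)) (words n)"
proof -
  let ?gens = "sets (G_alg M \<Psi> J (n - 1)) \<union>
      {{\<omega> \<in> space M. i \<in> generation \<Psi> n \<omega>} | i. i \<in> words n} \<union> J_sets M J n"
  have sub: "?gens \<subseteq> sets (G_alg M \<Psi> J n)"
  proof (intro Un_least)
    show "sets (G_alg M \<Psi> J (n - 1)) \<subseteq> sets (G_alg M \<Psi> J n)" by (rule sets_G_alg_mono) simp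
    show "J_sets M J n \<subseteq> sets (G_alg M \<Psi> J n)"
      unfolding sets_G_alg by (auto intro!: sigma_sets.Basic)
  qed (auto intro: generation_event_G_alg)
  have Pow: "?gens \<subseteq> Pow (space M)"
    by (rule order_trans[OF sub]) (use sets.space_closed[of "G_alg M \<Psi> J n"] in simp)
  have space: "space (G_pre_alg M \<Psi> J n) = space M"
    by (simp add: G_pre_alg_def space_measure_of_conv)
  have sets: "sets (G_pre_alg M \<Psi> J n) = sigma_sets (space M) ?gens"
    unfolding G_pre_alg_def using Pow by (rule sets_measure_of)
  show ?thesis
  proof (rule cond_indep_node_algebras[OF space])
    show "sets (G_pre_alg M \<Psi> J n) \<subseteq> sets (G_alg M \<Psi> J n)"
      unfolding sets using sets.sigma_sets_subset[OF sub] by simp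
    show "{\<omega> \<in> space M. j \<in> generation \<Psi> n \<omega>} \<in> sets (G_pre_alg M \<Psi> J n)" if "j \<in> words n" for j
      unfolding sets using that by (auto intro!: sigma_sets.Basic)
    have "{\<omega> \<in> space M. J n \<omega> = j} \<in> J_sets M J n" for j
      unfolding J_sets_iff by (rule exI[of _ "{j}"]) auto
    then show "{\<omega> \<in> space M. J n \<omega> = j} \<in> sets (G_pre_alg M \<Psi> J n)" for j
      unfolding sets by (intro sigma_sets.Basic) blast
  qed
qed

lemma prob_spine_at:
  assumes i: "i \<in> words k"
  shows "\<P>(\<omega> in Pt. J k \<omega> = i) =
    (\<Prod>r<k. \<integral>\<omega>. mark_C (\<psi> \<omega>) (i ! r) powr \<alpha> * indicator {\<omega>. enat (i ! r) \<le> mark_N (\<psi> \<omega>)} \<omega> \<partial>M)"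
proof -
  have "emeasure Pt {\<omega> \<in> space M. J k \<omega> = i} =
      (\<integral>\<^sup>+ \<omega>. indicator {\<omega> \<in> space M. J k \<omega> = i} \<omega> * likelihood \<alpha> \<Psi> J k \<omega> \<partial>M)"
    by (rule emeasure_Pt[OF J_event_eq_G_alg])
  also have "\<dots> = (\<integral>\<^sup>+ \<omega>. indicator {\<omega>. J k \<omega> = i} \<omega> * (likelihood \<alpha> \<Psi> J k \<omega> * 1) \<partial>M)"
    by (intro nn_integral_cong) (auto split: split_indicator)
  also have "\<dots> = (\<integral>\<^sup>+ \<omega>. path_weight \<alpha> \<Psi> i \<omega> * 1 \<partial>M)"
    by (rule nn_integral_likelihood_on_spine[OF i]) simp
  also have "\<dots> = (\<Prod>r<k. \<integral>\<^sup>+ \<omega>. child_weight \<alpha> (\<psi> \<omega>) (i ! r) \<partial>M)"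
    using nn_integral_path_weight[OF i] by simp
  also have "\<dots> = (\<Prod>r<k. ennreal (\<integral>\<omega>. mark_C (\<psi> \<omega>) (i ! r) powr \<alpha> *
      indicator {\<omega>. enat (i ! r) \<le> mark_N (\<psi> \<omega>)} \<omega> \<partial>M))"
  proof (rule prod.cong[OF refl])
    fix r assume "r \<in> {..<k}"
    then have "1 \<le> i ! r" using i by (auto simp: words_def)
    then have eq: "mark_C (\<psi> \<omega>) (i ! r) powr \<alpha> * indicator {\<omega>. enat (i ! r) \<le> mark_N (\<psi> \<omega>)} \<omega> =
        enn2real (child_weight \<alpha> (\<psi> \<omega>) (i ! r))" for \<omega>
      by (simp add: child_weight_def)
    have "(\<integral>\<^sup>+ \<omega>. child_weight \<alpha> (\<psi> \<omega>) (i ! r) \<partial>M) \<le> (\<integral>\<^sup>+ \<omega>. weight_sum \<alpha> (\<psi> \<omega>) \<partial>M)"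
      by (intro nn_integral_mono child_weight_le_weight_sum)
    then have fin: "(\<integral>\<^sup>+ \<omega>. child_weight \<alpha> (\<psi> \<omega>) (i ! r) \<partial>M) < \<top>"
      by (simp add: mean_weight_sum le_less_trans)
    have "(\<integral>\<omega>. enn2real (child_weight \<alpha> (\<psi> \<omega>) (i ! r)) \<partial>M) =
        enn2real (\<integral>\<^sup>+ \<omega>. ennreal (enn2real (child_weight \<alpha> (\<psi> \<omega>) (i ! r))) \<partial>M)"
      by (intro integral_eq_nn_integral) auto
    also have "(\<integral>\<^sup>+ \<omega>. ennreal (enn2real (child_weight \<alpha> (\<psi> \<omega>) (i ! r))) \<partial>M) =
        (\<integral>\<^sup>+ \<omega>. child_weight \<alpha> (\<psi> \<omega>) (i ! r) \<partial>M)"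
      by (intro nn_integral_cong) (simp add: child_weight_def)
    finally show "(\<integral>\<^sup>+ \<omega>. child_weight \<alpha> (\<psi> \<omega>) (i ! r) \<partial>M) =
      ennreal (\<integral>\<omega>. mark_C (\<psi> \<omega>) (i ! r) powr \<alpha> * indicator {\<omega>. enat (i ! r) \<le> mark_N (\<psi> \<omega>)} \<omega> \<partial>M)"
      using fin by (simp add: eq)
  qed
  also have "\<dots> = ennreal (\<Prod>r<k. \<integral>\<omega>. mark_C (\<psi> \<omega>) (i ! r) powr \<alpha> *
      indicator {\<omega>. enat (i ! r) \<le> mark_N (\<psi> \<omega>)} \<omega> \<partial>M)"
    by (intro prod_ennreal) simp
  finally show ?thesis
    by (simp add: measure_def prod_nonneg)
qed

text \<open>
  An event of $\mathcal{G}_k$ on which \<open>i\<close> is alive and the conditional law of its mark is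
  constant: this constant is then the elementary conditional probability as well.
\<close>

lemma cond_prob_Pt:
  assumes i: "i \<in> words k" and B: "B \<in> sets mark_space"
    and A: "{\<omega> \<in> space M. P \<omega>} \<in> sets (G_alg M \<Psi> J k)"
    and alive: "\<And>\<omega>. \<omega> \<in> space M \<Longrightarrow> P \<omega> \<Longrightarrow> i \<in> generation \<Psi> k \<omega>"
    and law: "\<And>\<omega>. \<omega> \<in> space M \<Longrightarrow> P \<omega> \<Longrightarrow> node_law k i B False \<omega> = q"
    and pos: "\<P>(\<omega> in Pt. P \<omega>) > 0"
  shows "ennreal \<P>(\<omega> in Pt. \<Psi> i \<omega> \<in> B \<bar> P \<omega>) = q"
proof -
  interpret Pt: prob_space Pt by (rule prob_space_Pt)
  let ?A = "{\<omega> \<in> space M. P \<omega>}"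
  have APt: "?A \<in> sets Pt" using A sets_G_alg_Pt by blast
  have "{\<omega> \<in> space M. \<Psi> i \<omega> \<in> B \<and> P \<omega>} = {\<omega> \<in> ?A. \<forall>j\<in>{i}. \<omega> \<in> node_event k j B False}"
    using alive by (auto simp: node_event_def)
  then have "emeasure Pt {\<omega> \<in> space M. \<Psi> i \<omega> \<in> B \<and> P \<omega>} =
      (\<integral>\<^sup>+ \<omega>. indicator ?A \<omega> * (\<Prod>j\<in>{i}. node_law k j B False \<omega>) \<partial>Pt)"
    using emeasure_Pt_node_events[OF A, of "{i}" "\<lambda>_. B" "\<lambda>_. False"] i B by simp
  also have "\<dots> = (\<integral>\<^sup>+ \<omega>. q * indicator ?A \<omega> \<partial>Pt)"
    using law by (intro nn_integral_cong) (auto split: split_indicator)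
  also have "\<dots> = q * emeasure Pt ?A"
    using APt by (rule nn_integral_cmult_indicator)
  finally have eq: "ennreal (Pt.prob {\<omega> \<in> space M. \<Psi> i \<omega> \<in> B \<and> P \<omega>}) = q * ennreal (Pt.prob ?A)"
    by (simp add: Pt.emeasure_eq_measure)
  have "ennreal \<P>(\<omega> in Pt. \<Psi> i \<omega> \<in> B \<bar> P \<omega>) =
      ennreal (Pt.prob {\<omega> \<in> space M. \<Psi> i \<omega> \<in> B \<and> P \<omega>}) / ennreal (Pt.prob ?A)"
    using pos by (simp add: cond_prob_def divide_ennreal)
  also have "\<dots> = q"
    unfolding eq using pos by (intro ennreal_mult_divide_eq) auto
  finally show ?thesis .
qed

lemma cond_prob_off_spine:
  assumes i: "i \<in> words k" and B: "B \<in> sets mark_space"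
    and pos: "\<P>(\<omega> in Pt. i \<in> generation \<Psi> k \<omega> \<and> i \<noteq> J k \<omega>) > 0"
  shows "\<P>(\<omega> in Pt. \<Psi> i \<omega> \<in> B \<bar> i \<in> generation \<Psi> k \<omega> \<and> i \<noteq> J k \<omega>) = \<P>(\<omega> in M. \<psi> \<omega> \<in> B)"
proof -
  have "{\<omega> \<in> space M. i \<in> generation \<Psi> k \<omega> \<and> i \<noteq> J k \<omega>} =
      {\<omega> \<in> space M. i \<in> generation \<Psi> k \<omega>} - {\<omega> \<in> space M. J k \<omega> = i}" by auto
  then have A: "{\<omega> \<in> space M. i \<in> generation \<Psi> k \<omega> \<and> i \<noteq> J k \<omega>} \<in> sets (G_alg M \<Psi> J k)"
    using generation_event_G_alg[OF i] J_event_eq_G_alg[of k i] by auto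
  have BM: "{\<omega> \<in> space M. \<psi> \<omega> \<in> B} \<in> events" using B by measurable
  have "(\<integral>\<^sup>+ \<omega>. indicator B (\<psi> \<omega>) \<partial>M) = (\<integral>\<^sup>+ \<omega>. indicator {\<omega> \<in> space M. \<psi> \<omega> \<in> B} \<omega> \<partial>M)"
    by (intro nn_integral_cong) (auto split: split_indicator)
  then have ind: "(\<integral>\<^sup>+ \<omega>. indicator B (\<psi> \<omega>) \<partial>M) = ennreal \<P>(\<omega> in M. \<psi> \<omega> \<in> B)"
    using BM by (simp add: emeasure_eq_measure)
  have "ennreal \<P>(\<omega> in Pt. \<Psi> i \<omega> \<in> B \<bar> i \<in> generation \<Psi> k \<omega> \<and> i \<noteq> J k \<omega>) = ennreal \<P>(\<omega> in M. \<psi> \<omega> \<in> B)"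
    by (rule cond_prob_Pt[OF i B A _ _ pos]) (auto simp: node_law_def ind)
  then show ?thesis by (simp add: cond_prob_def)
qed

lemma cond_prob_on_spine:
  assumes i: "i \<in> words k" and B: "B \<in> sets mark_space"
    and pos: "\<P>(\<omega> in Pt. i = J k \<omega>) > 0"
  shows "ennreal \<P>(\<omega> in Pt. \<Psi> i \<omega> \<in> B \<bar> i = J k \<omega>) =
    (\<integral>\<^sup>+ \<omega>. indicator B (\<psi> \<omega>) * weight_sum \<alpha> (\<psi> \<omega>) \<partial>M)"
proof (rule cond_prob_Pt[OF i B _ _ _ pos])
  show "{\<omega> \<in> space M. i = J k \<omega>} \<in> sets (G_alg M \<Psi> J k)"
    using J_event_eq_G_alg[of k i] by (simp only: eq_commute[of i])
qed (use J_in_generation in \<open>auto simp: node_law_def\<close>)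

end

theorem lemma2p5:
  fixes M Pt :: "'a measure"
    and \<psi> :: "'a \<Rightarrow> mark"
    and \<Psi> :: "nat list \<Rightarrow> 'a \<Rightarrow> mark"
    and J :: "nat \<Rightarrow> 'a \<Rightarrow> nat list"
    and \<alpha> :: real and k :: nat and i :: "nat list" and B :: "mark set"
  assumes "prob_space M"
    and "\<psi> \<in> measurable M mark_space"
    and "AE \<omega> in M. 0 \<le> mark_Q (\<psi> \<omega>) \<and> (\<forall>j\<ge>1. 0 \<le> mark_C (\<psi> \<omega>) j)"
    and "\<P>(\<omega> in M. 0 < mark_Q (\<psi> \<omega>)) > 0"
    and "\<alpha> > 0"
    and "(\<integral>\<^sup>+ \<omega>. weight_sum \<alpha> (\<psi> \<omega>) \<partial>M) = 1"
    and "AE \<omega> in M. summable (log_weight \<alpha> (\<psi> \<omega>))"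
    and "integrable M (\<lambda>\<omega>. \<Sum>r. log_weight \<alpha> (\<psi> \<omega>) r)"
    and "0 < (\<integral>\<omega>. (\<Sum>r. log_weight \<alpha> (\<psi> \<omega>) r) \<partial>M)"
    and "iid_marks M \<psi> \<Psi>"
    and "spine M \<alpha> \<Psi> J"
    and "tilted_measure M \<alpha> \<Psi> J Pt"
    and "i \<in> words k"
    and "B \<in> sets mark_space"
  shows "\<P>(\<omega> in Pt. J k \<omega> = i) =
           (\<Prod>r<k. \<integral>\<omega>. mark_C (\<psi> \<omega>) (i ! r) powr \<alpha> *
                       indicator {\<omega>. enat (i ! r) \<le> mark_N (\<psi> \<omega>)} \<omega> \<partial>M)
       \<and> (\<P>(\<omega> in Pt. i \<in> generation \<Psi> k \<omega> \<and> i \<noteq> J k \<omega>) > 0 \<longrightarrow>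
           \<P>(\<omega> in Pt. \<Psi> i \<omega> \<in> B \<bar> i \<in> generation \<Psi> k \<omega> \<and> i \<noteq> J k \<omega>) =
             \<P>(\<omega> in M. \<psi> \<omega> \<in> B))
       \<and> (\<P>(\<omega> in Pt. i = J k \<omega>) > 0 \<longrightarrow>
           ennreal \<P>(\<omega> in Pt. \<Psi> i \<omega> \<in> B \<bar> i = J k \<omega>) =
             (\<integral>\<^sup>+ \<omega>. indicator B (\<psi> \<omega>) * weight_sum \<alpha> (\<psi> \<omega>) \<partial>M))
       \<and> (\<forall>n\<ge>1.
           cond_indep_sets Pt (G_pre_alg M \<Psi> J n) (\<lambda>j. sets (node_algebra M \<Psi> j)) (words n) \<and>
           cond_indep_sets Pt (G_alg M \<Psi> J n) (\<lambda>j. sets (node_algebra M \<Psi> j)) (words n))"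
proof -
  interpret prob_space M by fact
  interpret tilted_branching_spine M \<psi> \<Psi> \<alpha> J Pt
    by unfold_locales fact+
  show ?thesis
    using assms(13,14) prob_spine_at cond_prob_off_spine cond_prob_on_spine
      cond_indep_G_pre_alg cond_indep_G_alg
    by (intro conjI impI allI) auto
qed

end
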